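(* Let $\alpha>\frac{\log 2}{2\pi}$. Let $k$ run through even positive integers tending to infinity and let $m=m(k)$ be positive integers with $m=\alpha k+o(k)$. Then there exists a constant $P_i(\alpha)>0$ such that the number of zeros of $P_{k,m}$ on $\mathcal{L}_i$ is at least $P_i(\alpha)\frac{k}{12}+o(k)$. In particular, a positive proportion of the zeros of $P_{k,m}$ in $\mathcal{F}$ lie on $\mathcal{L}_i$.
   Context: $\mathbb{H}=\{z:\operatorname{Im} z>0\}$. For even $k$ and integer $m\ge 1$, the Poincaré series is $P_{k,m}(z)=\frac12\sum_{c,d\in\mathbb{Z},\ \gcd(c,d)=1}\frac{\exp(2\pi i m\gamma z)}{(cz+d)^k}$, where for each coprime pair $(c,d)$, $\gamma=\begin{pmatrix}a&b\\c&d\end{pmatrix}$ is any matrix in $\mathrm{SL}(2,\mathbb{Z})$ with bottom row $(c,d)$ and $\gamma z=\frac{az+b}{cz+d}$. The fundamental domain is $\mathcal{F}=\{z\in\mathbb{H}: |z|>1,\ \operatorname{Re} z\in(-\frac12,\frac12]\}\cup\{z\in\mathbb{H}:|z|=1,\ \arg z\in[\frac{\pi}{3},\frac{\pi}{2}]\}$. $\mathcal{L}_i=\{ti: t\ge 1\}$. All asymptotic notation refers to $k\to\infty$, with implied constants allowed to depend on $\alpha$. *)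

theory Defs
  imports "HOL-Complex_Analysis.Complex_Analysis" "HOL-Library.Landau_Symbols"
begin

definition upper_half_plane :: "complex set" where
  "upper_half_plane = {z. Im z > 0}"

definition fractional_linear :: "int \<Rightarrow> int \<Rightarrow> int \<Rightarrow> int \<Rightarrow> complex \<Rightarrow> complex" where
  "fractional_linear a b c d z = (of_int a * z + of_int b) / (of_int c * z + of_int d)"

text \<open>A choice of top row \<open>(a, b)\<close> completing the coprime bottom row \<open>(c, d)\<close> to an element of
  \<open>SL(2, \<int>)\<close>; by \<open>poincare_term_eq\<close> below the choice does not affect the Poincare series.\<close>

definition top_row :: "int \<Rightarrow> int \<Rightarrow> int \<times> int" where
  "top_row c d = (SOME (a, b). a * d - b * c = 1)"

definition poincare_term :: "nat \<Rightarrow> nat \<Rightarrow> complex \<Rightarrow> int \<Rightarrow> int \<Rightarrow> complex" where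
  "poincare_term k m z c d =
     (case top_row c d of (a, b) \<Rightarrow>
        exp (2 * of_real pi * \<i> * of_nat m * fractional_linear a b c d z)
          / (of_int c * z + of_int d) ^ k)"

text \<open>The sum is unordered; it converges absolutely on the upper half-plane for \<open>k > 2\<close>.\<close>

definition poincare_series :: "nat \<Rightarrow> nat \<Rightarrow> complex \<Rightarrow> complex" where
  "poincare_series k m z =
     1 / 2 * (\<Sum>\<^sub>\<infinity>(c, d)\<in>{(c, d). coprime c d}. poincare_term k m z c d)"

definition fundamental_domain :: "complex set" where
  "fundamental_domain =
     {z \<in> upper_half_plane. norm z > 1 \<and> Re z \<in> {-1/2<..1/2}} \<union>
     {z \<in> upper_half_plane. norm z = 1 \<and> Arg z \<in> {pi/3..pi/2}}"

definition imaginary_line :: "complex set" where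
  "imaginary_line = {of_real t * \<i> | t::real. t \<ge> 1}"

definition zeros_in :: "(complex \<Rightarrow> complex) \<Rightarrow> complex set \<Rightarrow> complex set" where
  "zeros_in f S = {z \<in> S. f z = 0}"

text \<open>Zeros counted with multiplicity; meaningful only if \<open>zeros_in f S\<close> is finite and \<open>f\<close> is
  holomorphic and not locally zero near these points.\<close>

definition zero_count_mult :: "(complex \<Rightarrow> complex) \<Rightarrow> complex set \<Rightarrow> int" where
  "zero_count_mult f S = (\<Sum>z\<in>zeros_in f S. zorder f z)"

definition even_at_top :: "nat filter" where
  "even_at_top = inf at_top (principal {k. even k})"

lemma top_row_det:
  assumes "coprime c d" "top_row c d = (a, b)"
  shows "a * d - b * c = 1"
proof -
  obtain u v where "u * c + v * d = 1"
    using bezout_int[of c d] assms(1) by auto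
  then have "case (v, -u) of (a, b) \<Rightarrow> a * d - b * c = 1" by simp
  then have "case top_row c d of (a, b) \<Rightarrow> a * d - b * c = 1"
    unfolding top_row_def by (rule someI)
  with assms(2) show ?thesis by simp
qed

lemma poincare_term_eq:
  assumes z: "z \<in> upper_half_plane" and det: "a * d - b * c = 1"
  shows "poincare_term k m z c d =
           exp (2 * of_real pi * \<i> * of_nat m * fractional_linear a b c d z)
             / (of_int c * z + of_int d) ^ k"
proof -
  obtain a' b' where ab': "top_row c d = (a', b')" by fastforce
  have cop: "coprime c d"
  proof (rule coprimeI)
    fix e assume "e dvd c" "e dvd d"
    then have "e dvd a * d - b * c" by simp
    then show "is_unit e" using det by simp
  qed
  have det': "a' * d - b' * c = 1" using top_row_det[OF cop ab'] .
  have nz: "of_int c * z + of_int d \<noteq> 0"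
  proof
    assume h: "of_int c * z + of_int d = 0"
    then have "Im (of_int c * z + of_int d) = 0" by simp
    then have "c = 0" using z by (simp add: upper_half_plane_def)
    with h det show False by simp
  qed
  define n where "n = a' * b - a * b'"
  have ea: "a' = a - n * c"
  proof -
    have "a' = a' * (a * d - b * c)" using det by simp
    also have "\<dots> = a * (a' * d - b' * c) - n * c" by (simp add: n_def algebra_simps)
    finally show ?thesis using det' by simp
  qed
  have eb: "b' = b - n * d"
  proof -
    have "b' = b' * (a * d - b * c)" using det by simp
    also have "\<dots> = b * (a' * d - b' * c) - n * d" by (simp add: n_def algebra_simps)
    finally show ?thesis using det' by simp
  qed
  have shift: "fractional_linear a' b' c d z = fractional_linear a b c d z - of_int n"
  proof -
    have "(of_int a' * z + of_int b' :: complex) =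
            (of_int a * z + of_int b) - of_int n * (of_int c * z + of_int d)"
      by (simp add: ea eb algebra_simps)
    then show ?thesis using nz by (simp add: fractional_linear_def diff_divide_distrib)
  qed
  have "exp (2 * of_real pi * \<i> * of_nat m * fractional_linear a' b' c d z) =
        exp (2 * of_real pi * \<i> * of_nat m * fractional_linear a b c d z)"
    unfolding exp_eq shift
    by (rule exI[of _ "- (int m * n)"]) (simp add: algebra_simps)
  then show ?thesis by (simp add: poincare_term_def ab')
qed

end

theory Submission imports Defs begin

text \<open>
  At \<open>z = i y\<close> the term of the Poincare series with bottom row \<open>(c, d)\<close> has absolute value
  \<open>exp (- k G)\<close>, where, for \<open>\<beta> = m / k\<close> and \<open>r = c\<^sup>2 y\<^sup>2 + d\<^sup>2\<close>,
  \<open>G = 2 \<pi> \<beta> y / r + ln r / 2\<close>. The condition \<open>\<alpha> > ln 2 / (2 \<pi>)\<close> says precisely that at \<open>y = 1\<close>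
  the pair \<open>(1, 1)\<close> beats \<open>(0, 1)\<close> and \<open>(1, 0)\<close>, so near \<open>y = 1\<close> the minimum of \<open>G\<close> is attained at
  pairs with \<open>c d \<noteq> 0\<close>. By the identity theorem two different pairs have equal \<open>G\<close> only at isolated
  \<open>y\<close>, so on some interval a single pair \<open>(c, \<plusminus> d)\<close> dominates all others by an exponential factor.
  There the series is real and equals twice the real part of one term up to a smaller error; the phase
  of this term is \<open>k\<close> times a nonconstant function of \<open>y\<close>, and the sign changes give a number of zeros
  proportional to \<open>k\<close>.

  For the proportion, an upper bound \<open>O(k)\<close> on all zeros in the fundamental domain suffices, and the
  valence formula is not needed: in the variable \<open>q = exp (2 \<pi> i z)\<close> these zeros lie in a small disc,
  the series is at most \<open>A\<^sup>k\<close> on a disc more than five times larger, and at some point of the small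
  disc it is at least \<open>B\<^sup>-\<^sup>k\<close>; dividing out the zeros and applying the maximum principle bounds their number.
\<close>

section \<open>Decay rate and phase of the terms\<close>

definition decay_rate :: "real \<Rightarrow> real \<Rightarrow> real \<Rightarrow> real \<Rightarrow> real" where
  "decay_rate \<beta> y c d = 2 * pi * \<beta> * y / (c\<^sup>2 * y\<^sup>2 + d\<^sup>2) + ln (c\<^sup>2 * y\<^sup>2 + d\<^sup>2) / 2"

text \<open>For \<open>c, d > 0\<close> this is \<open>1 / k\<close> times the argument of the term
  at \<open>z = i y\<close>, up to a constant independent of \<open>y\<close>. The first summand
  comes from the real part of \<open>a / c - 1 / (c (c z + d))\<close>, with \<open>a / c\<close>
  dropped; the second is minus the argument of \<open>c z + d\<close>.\<close>

definition phase_rate :: "real \<Rightarrow> real \<Rightarrow> real \<Rightarrow> real \<Rightarrow> real" where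
  "phase_rate \<beta> y c d = - (2 * pi * \<beta> * d / (c * (c\<^sup>2 * y\<^sup>2 + d\<^sup>2))) - arctan (c * y / d)"

lemma square_form_pos:
  fixes c d y :: real
  assumes "y > 0" "c \<noteq> 0 \<or> d \<noteq> 0"
  shows "c\<^sup>2 * y\<^sup>2 + d\<^sup>2 > 0"
  using assms by (auto intro: add_pos_nonneg add_nonneg_pos)

lemma decay_rate_uminus [simp]:
  "decay_rate \<beta> y (- c) d = decay_rate \<beta> y c d" "decay_rate \<beta> y c (- d) = decay_rate \<beta> y c d"
  by (auto simp: decay_rate_def)

lemma decay_rate_abs [simp]: "decay_rate \<beta> y \<bar>c\<bar> \<bar>d\<bar> = decay_rate \<beta> y c d"
  by (auto simp: abs_if)

text \<open>Recovers \<open>d\<close> from the decay rate as a function of \<open>y\<close>;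
  combined with \<open>decay_rate_inverse\<close> it also recovers \<open>c\<close>.\<close>

lemma tendsto_decay_rate_0:
  assumes "d > 0"
  shows "((\<lambda>y. decay_rate \<alpha> y c d) \<longlongrightarrow> ln d) (at_right 0)"
proof -
  have "((\<lambda>y. decay_rate \<alpha> y c d) \<longlongrightarrow> 2 * pi * \<alpha> * 0 / (c\<^sup>2 * 0\<^sup>2 + d\<^sup>2) + ln (c\<^sup>2 * 0\<^sup>2 + d\<^sup>2) / 2) (at_right 0)"
    unfolding decay_rate_def using assms by (intro tendsto_intros) auto
  then show ?thesis using assms by (simp add: ln_realpow)
qed

text \<open>Reduces the limit at infinity to the one at \<open>0\<close>.\<close>

lemma decay_rate_inverse:
  assumes "y > 0" "c > 0" "d > 0"
  shows "decay_rate \<alpha> (1 / y) c d = decay_rate \<alpha> y d c - ln y"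
proof -
  have pos: "d\<^sup>2 * y\<^sup>2 + c\<^sup>2 > 0" by (rule square_form_pos) (use assms in auto)
  have eq: "c\<^sup>2 * (1 / y)\<^sup>2 + d\<^sup>2 = (d\<^sup>2 * y\<^sup>2 + c\<^sup>2) / y\<^sup>2" using assms by (simp add: field_simps)
  have "ln ((d\<^sup>2 * y\<^sup>2 + c\<^sup>2) / y\<^sup>2) / 2 = ln (d\<^sup>2 * y\<^sup>2 + c\<^sup>2) / 2 - ln y"
    using pos assms by (simp add: ln_div ln_realpow)
  moreover have "2 * pi * \<alpha> * (1 / y) / ((d\<^sup>2 * y\<^sup>2 + c\<^sup>2) / y\<^sup>2) = 2 * pi * \<alpha> * y / (d\<^sup>2 * y\<^sup>2 + c\<^sup>2)"
    using pos assms by (simp add: power2_eq_square)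
  ultimately show ?thesis unfolding decay_rate_def eq by simp
qed

text \<open>Both decay rates extend holomorphically to the right half-plane, so their difference is
  either constant there or has finitely many zeros on the compact segment. A nonzero constant gives
  no solutions. If the constant is zero, the limits at 0 force \<open>d = d'\<close> and those at
  infinity force \<open>c = c'\<close>.\<close>

lemma finite_decay_rate_eq:
  assumes pos: "c > 0" "d > 0" "c' > 0" "d' > 0" and ne: "(c, d) \<noteq> (c', d')"
  shows "finite {y \<in> {1..2}. decay_rate \<alpha> y c d = decay_rate \<alpha> y c' d'}"
proof -
  define S where "S = {w. Re w > 0}"
  define f where "f c d w = 2 * of_real (pi * \<alpha>) * w / ((of_real c)\<^sup>2 * w\<^sup>2 + (of_real d)\<^sup>2)
    + Ln ((of_real c)\<^sup>2 * w\<^sup>2 + (of_real d)\<^sup>2) / 2" for c d :: real and w :: complex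
  \<comment> \<open>The quadratic form stays off the branch cut of \<open>Ln\<close>: for
    \<open>Re w > 0\<close> its imaginary part vanishes only for real \<open>w\<close>, and there it
    is positive.\<close>
  have q: "(of_real c)\<^sup>2 * w\<^sup>2 + (of_real d)\<^sup>2 \<notin> \<real>\<^sub>\<le>\<^sub>0" if "w \<in> S" "c > 0" "d > 0" for c d :: real and w :: complex
  proof
    assume "(of_real c)\<^sup>2 * w\<^sup>2 + (of_real d)\<^sup>2 \<in> \<real>\<^sub>\<le>\<^sub>0"
    then have "(of_real (c\<^sup>2) * w\<^sup>2 + of_real (d\<^sup>2)) \<in> \<real>\<^sub>\<le>\<^sub>0" by simp
    then have *: "Im (of_real (c\<^sup>2) * w\<^sup>2 + of_real (d\<^sup>2)) = 0" "Re (of_real (c\<^sup>2) * w\<^sup>2 + of_real (d\<^sup>2)) \<le> 0"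
      by (simp_all only: complex_nonpos_Reals_iff)
    from *(1) have "Im w = 0" using that by (simp add: S_def power2_eq_square)
    with *(2) have "c\<^sup>2 * (Re w)\<^sup>2 + d\<^sup>2 \<le> 0" by simp
    then show False using square_form_pos[of "Re w" c d] that by (simp add: S_def)
  qed
  have f_hol: "f c d holomorphic_on S" if "c > 0" "d > 0" for c d
  proof -
    have "(of_real c)\<^sup>2 * w\<^sup>2 + (of_real d)\<^sup>2 \<noteq> (0::complex)" if "w \<in> S" for w
      using q[OF that \<open>c > 0\<close> \<open>d > 0\<close>] by (metis complex_nonpos_Reals_iff zero_complex.sel order_refl)
    with q[OF _ that] show ?thesis unfolding f_def by (intro holomorphic_intros) auto
  qed
  have f_real: "f c d (of_real y) = of_real (decay_rate \<alpha> y c d)" if "y > 0" "c > 0" "d > 0" for c d y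
  proof -
    have "c\<^sup>2 * y\<^sup>2 + d\<^sup>2 > 0" using that by (intro square_form_pos) auto
    then have "Ln (of_real (c\<^sup>2 * y\<^sup>2 + d\<^sup>2)) = of_real (ln (c\<^sup>2 * y\<^sup>2 + d\<^sup>2))" by (rule Ln_of_real)
    then show ?thesis by (simp add: f_def decay_rate_def)
  qed
  define F where "F w = f c d w - f c' d' w" for w
  have F: "F holomorphic_on S" unfolding F_def using pos by (intro holomorphic_intros f_hol)
  have F_real: "F (of_real y) = of_real (decay_rate \<alpha> y c d - decay_rate \<alpha> y c' d')" if "y > 0" for y
    using that pos by (simp add: F_def f_real)
  show ?thesis
  proof (cases "F constant_on S")
    case True
    then obtain K where K: "\<And>w. w \<in> S \<Longrightarrow> F w = K" by (auto simp: constant_on_def)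
    show ?thesis
    proof (cases "K = 0")
      case True
      have eq: "decay_rate \<alpha> y c d = decay_rate \<alpha> y c' d'" if "y > 0" for y
        using F_real[OF that] K[of "of_real y"] that True by (simp add: S_def)
      have lim: "((\<lambda>y. decay_rate \<alpha> y c d) \<longlongrightarrow> ln d') (at_right 0)"
        by (rule Lim_transform_eventually[OF tendsto_decay_rate_0[OF pos(4)]])
           (auto simp: eq eventually_at_right_less eventually_at intro!: exI[of _ 1])
      have d: "d = d'"
        using tendsto_unique[OF _ lim tendsto_decay_rate_0[OF pos(2)]] pos by simp
      have eq': "decay_rate \<alpha> y d c = decay_rate \<alpha> y d' c'" if "y > 0" for y
        using eq[of "1 / y"] decay_rate_inverse[OF that] pos that by simp
      have lim: "((\<lambda>y. decay_rate \<alpha> y d c) \<longlongrightarrow> ln c') (at_right 0)"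
        by (rule Lim_transform_eventually[OF tendsto_decay_rate_0[OF pos(3)]])
           (auto simp: eq' eventually_at_right_less eventually_at intro!: exI[of _ 1])
      have "c = c'"
        using tendsto_unique[OF _ lim tendsto_decay_rate_0[OF pos(1)]] pos by simp
      with d ne show ?thesis by simp
    next
      case False
      have "decay_rate \<alpha> y c d \<noteq> decay_rate \<alpha> y c' d'" if "y \<in> {1..2}" for y
      proof -
        have "y > 0" using that by simp
        then show ?thesis using F_real[of y] K[of "of_real y"] False by (auto simp: S_def)
      qed
      then have "{y \<in> {1..2}. decay_rate \<alpha> y c d = decay_rate \<alpha> y c' d'} = {}" by blast
      then show ?thesis by (simp only: finite.emptyI)
    qed
  next
    case False
    have "finite {w \<in> of_real ` {1..2}. F w = 0}"
    proof (rule holomorphic_compact_finite_zeros[OF F _ _ _ _ False])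
      show "open S" unfolding S_def by (rule open_halfspace_Re_gt)
      show "connected S" unfolding S_def by (simp add: convex_connected convex_halfspace_Re_gt)
      show "compact (complex_of_real ` {1..2})" by (intro compact_continuous_image continuous_intros) auto
      show "complex_of_real ` {1..2} \<subseteq> S" by (auto simp: S_def)
    qed
    moreover have "of_real ` {y \<in> {1..2}. decay_rate \<alpha> y c d = decay_rate \<alpha> y c' d'} \<subseteq> {w \<in> of_real ` {1..2}. F w = 0}"
      using F_real by auto
    ultimately have "finite (complex_of_real ` {y \<in> {1..2}. decay_rate \<alpha> y c d = decay_rate \<alpha> y c' d'})"
      by (rule rev_finite_subset)
    then show ?thesis by (rule finite_imageD) (auto simp: inj_on_def)
  qed
qed

text \<open>A lower bound uniform in \<beta> and \<open>y\<close>. It serves twice: to discard all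
  but finitely many pairs in the search for the dominant one, and to keep the sum over the
  non-dominant pairs convergent.\<close>

lemma decay_rate_ge:
  assumes "\<beta> \<ge> 0" "y \<ge> 1" "c\<^sup>2 + d\<^sup>2 \<ge> 1"
  shows "decay_rate \<beta> y c d \<ge> ln (c\<^sup>2 + d\<^sup>2) / 2"
proof -
  have "c\<^sup>2 * 1 \<le> c\<^sup>2 * y\<^sup>2" using assms by (intro mult_left_mono) (auto simp: one_le_power)
  then have "ln (c\<^sup>2 + d\<^sup>2) \<le> ln (c\<^sup>2 * y\<^sup>2 + d\<^sup>2)" using assms by (intro ln_mono) auto
  moreover have "0 \<le> 2 * pi * \<beta> * y / (c\<^sup>2 * y\<^sup>2 + d\<^sup>2)" using assms by simp
  ultimately show ?thesis by (simp add: decay_rate_def)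
qed

text \<open>Joint continuity in \<beta> and \<open>y\<close>, because \<open>\<beta> = m / k\<close>
  only tends to \<alpha> and inequalities at \<alpha> must persist for nearby \<beta>.\<close>

lemma isCont_decay_rate:
  assumes "y > 0" "c \<noteq> 0 \<or> d \<noteq> 0"
  shows "isCont (\<lambda>p. decay_rate (fst p) (snd p) c d) (\<beta>, y)"
  unfolding decay_rate_def using square_form_pos[OF assms] by (intro continuous_intros) auto

text \<open>In this factored form the critical points of the phase are the solutions of the
  quadratic equation treated in \<open>finite_square_form_eq\<close>, hence finite in
  number.\<close>

lemma phase_rate_DERIV:
  assumes "y > 0" "c > 0" "d > 0"
  shows "((\<lambda>y. phase_rate \<beta> y c d) has_real_derivative
     c * d / (c\<^sup>2 * y\<^sup>2 + d\<^sup>2) * (4 * pi * \<beta> * y / (c\<^sup>2 * y\<^sup>2 + d\<^sup>2) - 1)) (at y)"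
proof -
  define r where "r = c\<^sup>2 * y\<^sup>2 + d\<^sup>2"
  have r: "r > 0" unfolding r_def by (rule square_form_pos) (use assms in auto)
  have "((\<lambda>y. phase_rate \<beta> y c d) has_real_derivative
     2 * pi * \<beta> * d * (c * (c\<^sup>2 * (2 * y))) / (c * r)\<^sup>2 - inverse (1 + (c * y / d)\<^sup>2) * (c / d)) (at y)"
    unfolding phase_rate_def r_def
    by (rule derivative_eq_intros refl | use r assms in \<open>simp add: r_def power2_eq_square\<close>)+
  also have "inverse (1 + (c * y / d)\<^sup>2) * (c / d) = c * d / r"
    using assms r by (simp add: r_def field_simps power2_eq_square)
  also have "2 * pi * \<beta> * d * (c * (c\<^sup>2 * (2 * y))) / (c * r)\<^sup>2 - c * d / r = c * d / r * (4 * pi * \<beta> * y / r - 1)"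
    using assms r by (simp add: field_simps power2_eq_square)
  finally show ?thesis by (simp add: r_def)
qed

section \<open>Choice of the dominant pair\<close>

lemma isCont_tendsto_nhds: "isCont f x \<Longrightarrow> (f \<longlongrightarrow> f x) (nhds x)"
  by (simp add: isCont_def tendsto_at_iff_tendsto_nhds)

lemma finite_square_form_eq:
  fixes c d t :: real
  assumes "c \<noteq> 0"
  shows "finite {y. c\<^sup>2 * y\<^sup>2 + d\<^sup>2 = t * y}"
proof -
  have "finite {y. poly [:d\<^sup>2, - t, c\<^sup>2:] y = 0}"
    using assms by (intro poly_roots_finite) auto
  moreover have "{y. c\<^sup>2 * y\<^sup>2 + d\<^sup>2 = t * y} = {y. poly [:d\<^sup>2, - t, c\<^sup>2:] y = 0}"
    by (auto simp: power2_eq_square algebra_simps)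
  ultimately show ?thesis by simp
qed

text \<open>At \<open>y = 1\<close> both axis pairs have rate \<open>2 \<pi> \<alpha>\<close>,
  whereas \<open>(1, 1)\<close> has \<open>\<pi> \<alpha> + ln 2 / 2\<close>, which is smaller
  exactly under the hypothesis on \<alpha>. Continuity extends the strict inequalities to the right
  of 1.\<close>

lemma decay_rate_1_1_less_axes:
  assumes \<alpha>: "\<alpha> > ln 2 / (2 * pi)"
  shows "\<exists>\<epsilon>>0. \<forall>y\<in>{1..1+\<epsilon>}. decay_rate \<alpha> y 1 1 < decay_rate \<alpha> y 0 1 \<and> decay_rate \<alpha> y 1 1 < decay_rate \<alpha> y 1 0"
proof -
  have less: "ln 2 < 2 * pi * \<alpha>" using \<alpha> by (simp add: field_simps)
  have cont: "isCont (\<lambda>y. decay_rate \<alpha> y c d) 1" if "c \<noteq> 0 \<or> d \<noteq> 0" for c d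
    unfolding decay_rate_def using square_form_pos[of 1 c d] that by (intro continuous_intros) auto
  have "\<forall>\<^sub>F y in nhds 1. decay_rate \<alpha> y c d - decay_rate \<alpha> y 1 1 > 0" if "c = 0 \<and> d = 1 \<or> c = 1 \<and> d = 0" for c d
  proof (rule order_tendstoD(1))
    show "((\<lambda>y. decay_rate \<alpha> y c d - decay_rate \<alpha> y 1 1) \<longlongrightarrow> decay_rate \<alpha> 1 c d - decay_rate \<alpha> 1 1 1) (nhds 1)"
      using that by (intro tendsto_diff isCont_tendsto_nhds cont) auto
    show "0 < decay_rate \<alpha> 1 c d - decay_rate \<alpha> 1 1 1"
      using that less by (auto simp: decay_rate_def)
  qed
  from eventually_conj[OF this[of 0 1] this[of 1 0]] obtain e where e: "e > 0" "\<And>y. dist y 1 < e \<Longrightarrow> decay_rate \<alpha> y 0 1 - decay_rate \<alpha> y 1 1 > 0 \<and> decay_rate \<alpha> y 1 0 - decay_rate \<alpha> y 1 1 > 0"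
    unfolding eventually_nhds_metric by auto
  show ?thesis
  proof (intro exI[of _ "e/2"] conjI ballI)
    fix y assume "y \<in> {1..1 + e/2}"
    then have "dist y 1 < e" using e(1) by (simp add: dist_real_def)
    with e(2) show "decay_rate \<alpha> y 1 1 < decay_rate \<alpha> y 0 1" "decay_rate \<alpha> y 1 1 < decay_rate \<alpha> y 1 0" by fastforce+
  qed (use e in auto)
qed

text \<open>Only finitely many pairs can compete, since far pairs have large decay rates. At a point
  \<open>y0\<close> slightly above 1 that avoids all ties, the minimum is attained by a single pair,
  and not on the axes because \<open>(1, 1)\<close> is better. Strictness then spreads by continuity
  to \<beta> near \<alpha> and \<open>y\<close> in an interval starting at \<open>y0\<close>. As
  \<open>y0\<close> also avoids critical points of the phase, the phase changes across that interval
  once it is short enough.\<close>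

lemma dominant_pair:
  assumes \<alpha>: "\<alpha> > ln 2 / (2 * pi)"
  obtains c d :: int and a b \<delta> \<eta> \<kappa> :: real
  where "c > 0" "d > 0" "coprime c d" "1 \<le> a" "a < b" "\<delta> > 0" "\<eta> > 0" "\<kappa> > 0"
    "\<And>\<beta> y c' d'. \<lbrakk>\<beta> \<ge> 0; \<bar>\<beta> - \<alpha>\<bar> < \<eta>; a \<le> y; y \<le> b; coprime c' d'; (\<bar>c'\<bar>, \<bar>d'\<bar>) \<noteq> (c, d)\<rbrakk>
       \<Longrightarrow> decay_rate \<beta> y c d + \<delta> \<le> decay_rate \<beta> y c' d'"
    "\<And>\<beta>. \<bar>\<beta> - \<alpha>\<bar> < \<eta> \<Longrightarrow> \<kappa> \<le> \<bar>phase_rate \<beta> b c d - phase_rate \<beta> a c d\<bar>"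
proof -
  define G where "G \<beta> y p = decay_rate \<beta> y (of_int (fst p)) (of_int (snd p))" for \<beta> y and p :: "int \<times> int"
  have "ln 2 / (2 * pi) > 0" by simp
  then have \<alpha>0: "\<alpha> > 0" using \<alpha> by linarith
  obtain \<epsilon> where \<epsilon>: "\<epsilon> > 0" "\<And>y. y \<in> {1..1+\<epsilon>} \<Longrightarrow> G \<alpha> y (1, 1) < G \<alpha> y (0, 1) \<and> G \<alpha> y (1, 1) < G \<alpha> y (1, 0)"
    using decay_rate_1_1_less_axes[OF \<alpha>] by (auto simp: G_def)
  \<comment> \<open>An upper bound for the rate of \<open>(1, 1)\<close> on \<open>[1, 2]\<close>,
    from \<open>y / (y^2 + 1) \<le> 1\<close> and \<open>y^2 + 1 \<le> 5\<close>. The minimal rate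
    is therefore at most \<open>L\<close>, while outside the box of size \<open>N\<close> all rates
    are at least \<open>L + 1\<close>.\<close>
  define L where "L = 2 * pi * \<alpha> + ln 5 / 2"
  have G11: "G \<alpha> y (1, 1) \<le> L" if "y \<in> {1..2}" for y
  proof -
    have "y \<le> y\<^sup>2" using that by (simp add: self_le_power)
    then have "y / (y\<^sup>2 + 1) \<le> 1" by (simp add: divide_le_eq add_pos_nonneg)
    then have "2 * pi * \<alpha> * (y / (y\<^sup>2 + 1)) \<le> 2 * pi * \<alpha> * 1" using \<alpha>0 by (intro mult_left_mono) auto
    moreover have "y\<^sup>2 \<le> 2\<^sup>2" using that by (intro power_mono) auto
    then have "ln (y\<^sup>2 + 1) \<le> ln 5" by (intro ln_mono) (auto simp: add_nonneg_pos)
    ultimately show ?thesis by (simp add: G_def decay_rate_def L_def)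
  qed
  obtain N :: nat where N: "real N \<ge> exp (L + 1)" using real_arch_simple by blast
  have N1: "N \<ge> 1" using N by (metis One_nat_def Suc_leI exp_gt_zero less_le_trans of_nat_0_less_iff)
  have far: "G \<beta> y p \<ge> L + 1" if "\<beta> \<ge> 0" "y \<ge> 1" "\<bar>fst p\<bar> > int N \<or> \<bar>snd p\<bar> > int N" for \<beta> y p
  proof -
    define u v where "u = real_of_int (fst p)" and "v = real_of_int (snd p)"
    have "\<bar>u\<bar> \<ge> real N \<or> \<bar>v\<bar> \<ge> real N" using that(3) by (auto simp: u_def v_def)
    then have "(real N)\<^sup>2 \<le> u\<^sup>2 \<or> (real N)\<^sup>2 \<le> v\<^sup>2"
      by (metis of_nat_0_le_iff power2_abs power_mono)
    then have uv: "(real N)\<^sup>2 \<le> u\<^sup>2 + v\<^sup>2" by (smt (verit) zero_le_power2)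
    have "1 \<le> (real N)\<^sup>2" using N1 by (simp add: one_le_power)
    then have uv1: "1 \<le> u\<^sup>2 + v\<^sup>2" using uv by linarith
    have "L + 1 = ln (exp (L + 1))" by simp
    also have "\<dots> \<le> ln (real N)" using N N1 by (intro ln_mono) auto
    also have "\<dots> = ln ((real N)\<^sup>2) / 2" using N1 by (simp add: ln_realpow)
    also have "\<dots> \<le> ln (u\<^sup>2 + v\<^sup>2) / 2" using uv uv1 N1 by (intro divide_right_mono ln_mono) auto
    also have "\<dots> \<le> G \<beta> y p" unfolding G_def u_def[symmetric] v_def[symmetric]
      using that uv1 by (intro decay_rate_ge)
    finally show ?thesis .
  qed
  define S where "S = {p \<in> {1..int N} \<times> {1..int N}. coprime (fst p) (snd p)}"
  have finS: "finite S" by (simp add: S_def)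
  have S11: "(1, 1) \<in> S" using N1 by (simp add: S_def)
  have Spos: "fst p > 0" "snd p > 0" if "p \<in> S" for p using that by (auto simp: S_def)
  \<comment> \<open>The finitely many \<open>y\<close> to avoid: ties between two candidate pairs,
    and critical points of the phase of a candidate.\<close>
  define bad where "bad = (\<Union>p\<in>S. \<Union>q\<in>S - {p}. {y \<in> {1..2}. G \<alpha> y p = G \<alpha> y q})
    \<union> (\<Union>p\<in>S. {y. (of_int (fst p))\<^sup>2 * y\<^sup>2 + (of_int (snd p))\<^sup>2 = 4 * pi * \<alpha> * y})"
  have "finite bad" unfolding bad_def
  proof (intro finite_UnI finite_UN_I finS finite_Diff)
    show "finite {y \<in> {1..2}. G \<alpha> y p = G \<alpha> y q}" if "p \<in> S" "q \<in> S - {p}" for p q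
      unfolding G_def using Spos[of p] Spos[of q] that
      by (intro finite_decay_rate_eq) (auto simp: prod_eq_iff)
    show "finite {y. (real_of_int (fst p))\<^sup>2 * y\<^sup>2 + (of_int (snd p))\<^sup>2 = 4 * pi * \<alpha> * y}" if "p \<in> S" for p
      by (rule finite_square_form_eq) (use Spos[OF that] in auto)
  qed
  moreover have "infinite {1<..<min 2 (1 + \<epsilon>)}" using \<epsilon>(1) by (intro infinite_Ioo) auto
  ultimately obtain y0 where y0: "y0 \<in> {1<..<min 2 (1 + \<epsilon>)}" "y0 \<notin> bad"
    by (meson finite_subset subsetI)
  have "\<exists>p\<in>S. \<forall>q\<in>S. G \<alpha> y0 p \<le> G \<alpha> y0 q"
    using finS S11 by (metis (mono_tags) arg_min_if_finite(1) arg_min_least empty_iff)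
  then obtain p where p: "p \<in> S" and pmin: "\<And>q. q \<in> S \<Longrightarrow> G \<alpha> y0 p \<le> G \<alpha> y0 q" by blast
  define c d where "c = fst p" and "d = snd p"
  have cd: "c > 0" "d > 0" "coprime c d" using p by (auto simp: c_def d_def S_def)
  \<comment> \<open>All rivals of \<open>p\<close> inside the box, up to signs:
    \<open>(0, 1)\<close> and \<open>(1, 0)\<close> are the only coprime pairs of nonnegative
    integers with a zero entry.\<close>
  define S' where "S' = S \<union> {(0, 1), (1, 0)} - {p}"
  have finS': "finite S'" using finS by (simp add: S'_def)
  have strict: "G \<alpha> y0 p < G \<alpha> y0 q" if "q \<in> S'" for q
  proof (cases "q \<in> S")
    case True
    then have "G \<alpha> y0 p \<noteq> G \<alpha> y0 q" using y0 p that by (fastforce simp: bad_def S'_def)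
    then show ?thesis using pmin[OF True] by simp
  next
    case False
    then have "q = (0, 1) \<or> q = (1, 0)" using that by (auto simp: S'_def)
    then have "G \<alpha> y0 (1, 1) < G \<alpha> y0 q" using \<epsilon>(2)[of y0] y0 by auto
    then show ?thesis using pmin[OF S11] by simp
  qed
  have Gp_le: "G \<alpha> y0 p \<le> L" using pmin[OF S11] G11[of y0] y0 by auto
  \<comment> \<open>Half of the smallest gap at \<open>y0\<close>, so that the gaps remain above it
    in a neighbourhood. The inserted 1 makes the set visibly nonempty.\<close>
  define \<delta>0 where "\<delta>0 = Min (insert 1 ((\<lambda>q. G \<alpha> y0 q - G \<alpha> y0 p) ` S')) / 2"
  have \<delta>0: "\<delta>0 > 0" unfolding \<delta>0_def using finS' strict by (auto simp: Min_gr_iff)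
  have \<delta>0_less: "\<delta>0 < G \<alpha> y0 q - G \<alpha> y0 p" if "q \<in> S'" for q
  proof -
    have "Min (insert 1 ((\<lambda>q. G \<alpha> y0 q - G \<alpha> y0 p) ` S')) \<le> G \<alpha> y0 q - G \<alpha> y0 p"
      using finS' that by (intro Min_le) auto
    then show ?thesis using \<delta>0 unfolding \<delta>0_def by linarith
  qed
  have cont: "((\<lambda>x. G (fst x) (snd x) q) \<longlongrightarrow> G \<alpha> y0 q) (nhds (\<alpha>, y0))" if "q \<in> insert p S'" for q
  proof -
    have "fst q \<noteq> 0 \<or> snd q \<noteq> 0" using that Spos[of q] p by (auto simp: S'_def)
    then have "isCont (\<lambda>x. G (fst x) (snd x) q) (\<alpha>, y0)"
      unfolding G_def using y0 by (intro isCont_decay_rate) auto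
    from isCont_tendsto_nhds[OF this] show ?thesis by simp
  qed
  \<comment> \<open>The bound \<open>L + 1/2\<close> on the rate of \<open>p\<close> leaves a gap of
    \<open>1/2\<close> to the pairs outside the box; this is why the final gap is
    \<open>min \<delta>0 (1/2)\<close>.\<close>
  have "\<forall>\<^sub>F x in nhds (\<alpha>, y0). (\<forall>q\<in>S'. \<delta>0 < G (fst x) (snd x) q - G (fst x) (snd x) p) \<and> G (fst x) (snd x) p < L + 1/2"
  proof (intro eventually_conj eventually_ball_finite finS' ballI)
    show "\<forall>\<^sub>F x in nhds (\<alpha>, y0). \<delta>0 < G (fst x) (snd x) q - G (fst x) (snd x) p" if "q \<in> S'" for q
      by (rule order_tendstoD(1)[OF tendsto_diff[OF cont cont]]) (use that \<delta>0_less in auto)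
    show "\<forall>\<^sub>F x in nhds (\<alpha>, y0). G (fst x) (snd x) p < L + 1/2"
      by (rule order_tendstoD(2)[OF cont]) (use Gp_le in auto)
  qed
  then obtain Pf Pg where Pf: "eventually Pf (nhds \<alpha>)" and Pg: "eventually Pg (nhds y0)"
    and PP: "\<And>\<beta> y. Pf \<beta> \<Longrightarrow> Pg y \<Longrightarrow> (\<forall>q\<in>S'. \<delta>0 < G \<beta> y q - G \<beta> y p) \<and> G \<beta> y p < L + 1/2"
    unfolding nhds_prod eventually_prod_filter by auto
  obtain \<eta>1 where \<eta>1: "\<eta>1 > 0" "\<And>\<beta>. \<bar>\<beta> - \<alpha>\<bar> < \<eta>1 \<Longrightarrow> Pf \<beta>"
    using Pf unfolding eventually_nhds_metric dist_real_def by blast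
  obtain e where e: "e > 0" "\<And>y. \<bar>y - y0\<bar> < e \<Longrightarrow> Pg y"
    using Pg unfolding eventually_nhds_metric dist_real_def by blast
  have y0pos: "y0 > 0" using y0 by simp
  define D where "D = c * d / ((of_int c)\<^sup>2 * y0\<^sup>2 + (of_int d)\<^sup>2) * (4 * pi * \<alpha> * y0 / ((of_int c)\<^sup>2 * y0\<^sup>2 + (of_int d)\<^sup>2) - 1)"
  have DERIV: "((\<lambda>y. phase_rate \<alpha> y c d) has_real_derivative D) (at y0)"
    unfolding D_def using phase_rate_DERIV[OF y0pos, of c d \<alpha>] cd by simp
  have "D \<noteq> 0"
  proof -
    have "(real_of_int c)\<^sup>2 * y0\<^sup>2 + (of_int d)\<^sup>2 > 0" using y0pos cd by (intro square_form_pos) auto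
    moreover have "(of_int c)\<^sup>2 * y0\<^sup>2 + (of_int d)\<^sup>2 \<noteq> 4 * pi * \<alpha> * y0"
      using y0(2) p by (auto simp: bad_def c_def d_def)
    ultimately show ?thesis using cd by (auto simp: D_def)
  qed
  \<comment> \<open>A nonzero derivative makes the phase differ from its value at \<open>y0\<close>
    at all points shortly to the right; this fixes the right end point \<open>b\<close>.\<close>
  then obtain e2 where e2: "e2 > 0" "\<And>h. 0 < h \<Longrightarrow> h < e2 \<Longrightarrow> phase_rate \<alpha> (y0 + h) c d \<noteq> phase_rate \<alpha> y0 c d"
  proof (cases "D > 0")
    case True
    show ?thesis using DERIV_pos_inc_right[OF DERIV True] that by (metis less_irrefl)
  next
    case False
    then have "D < 0" using \<open>D \<noteq> 0\<close> by simp
    show ?thesis using DERIV_neg_dec_right[OF DERIV \<open>D < 0\<close>] that by (metis less_irrefl)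
  qed
  define h where "h = min e e2 / 2"
  have h: "0 < h" "h < e" "h < e2" using e e2 by (auto simp: h_def)
  define b where "b = y0 + h"
  \<comment> \<open>Half of the phase change at \<alpha>, so that it remains a lower bound for
    nearby \<beta>.\<close>
  define \<kappa> where "\<kappa> = \<bar>phase_rate \<alpha> b c d - phase_rate \<alpha> y0 c d\<bar> / 2"
  have \<kappa>: "\<kappa> > 0" using e2(2)[OF h(1,3)] by (simp add: \<kappa>_def b_def)
  have "isCont (\<lambda>\<beta>. \<bar>phase_rate \<beta> b c d - phase_rate \<beta> y0 c d\<bar>) \<alpha>"
    unfolding phase_rate_def divide_inverse by (intro continuous_intros)
  from isCont_tendsto_nhds[OF this]
  have "\<forall>\<^sub>F \<beta> in nhds \<alpha>. \<kappa> < \<bar>phase_rate \<beta> b c d - phase_rate \<beta> y0 c d\<bar>"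
    by (rule order_tendstoD(1)) (use \<kappa> in \<open>auto simp: \<kappa>_def\<close>)
  then obtain \<eta>2 where \<eta>2: "\<eta>2 > 0" "\<And>\<beta>. \<bar>\<beta> - \<alpha>\<bar> < \<eta>2 \<Longrightarrow> \<kappa> < \<bar>phase_rate \<beta> b c d - phase_rate \<beta> y0 c d\<bar>"
    unfolding eventually_nhds_metric dist_real_def by blast
  show thesis
  proof (rule that[of c d y0 b "min \<delta>0 (1/2)" "min \<eta>1 \<eta>2" \<kappa>])
    show "1 \<le> y0" "y0 < b" using y0 h by (auto simp: b_def)
    show "decay_rate \<beta> y c d + min \<delta>0 (1/2) \<le> decay_rate \<beta> y c' d'"
      if A: "\<beta> \<ge> 0" "\<bar>\<beta> - \<alpha>\<bar> < min \<eta>1 \<eta>2" "y0 \<le> y" "y \<le> b" "coprime c' d'" "(\<bar>c'\<bar>, \<bar>d'\<bar>) \<noteq> (c, d)" for \<beta> y c' d'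
    proof -
      have y: "\<bar>y - y0\<bar> < e" "y \<ge> 1" using A h y0 by (auto simp: b_def)
      note near = PP[OF \<eta>1(2) e(2)[OF y(1)], of \<beta>]
      define q where "q = (\<bar>c'\<bar>, \<bar>d'\<bar>)"
      have Gq: "G \<beta> y q = decay_rate \<beta> y c' d'" by (simp add: G_def q_def)
      have Gp: "G \<beta> y p = decay_rate \<beta> y c d" by (simp add: G_def c_def d_def)
      have "G \<beta> y p + min \<delta>0 (1/2) \<le> G \<beta> y q"
      proof (cases "\<bar>c'\<bar> > int N \<or> \<bar>d'\<bar> > int N")
        case True
        then have "L + 1 \<le> G \<beta> y q" using A(1) y(2) by (intro far) (auto simp: q_def)
        then show ?thesis using near A by auto
      next
        case False
        have "q \<noteq> p" using A(6) by (auto simp: q_def c_def d_def)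
        moreover have "q \<in> S \<union> {(0, 1), (1, 0)}"
        proof (cases "c' = 0 \<or> d' = 0")
          case True
          then show ?thesis using A(5) by (auto simp: q_def)
        next
          case F: False
          then show ?thesis using A(5) False by (auto simp: q_def S_def)
        qed
        ultimately have "q \<in> S'" by (simp add: S'_def)
        then show ?thesis using near A by force
      qed
      then show ?thesis by (simp add: Gp Gq)
    qed
    show "\<kappa> \<le> \<bar>phase_rate \<beta> b c d - phase_rate \<beta> y0 c d\<bar>" if "\<bar>\<beta> - \<alpha>\<bar> < min \<eta>1 \<eta>2" for \<beta>
      using \<eta>2(2)[of \<beta>] that by simp
  qed (use cd \<delta>0 \<eta>1 \<eta>2 \<kappa> in auto)
qed

section \<open>Counting zeros by growth\<close>

text \<open>Zeros are divided out one point at a time, and each quotient extends holomorphically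
  over the removed point. Points of \<open>A\<close> where \<open>f\<close> does not vanish have
  order 0 and contribute a factor 1.\<close>

lemma holomorphic_factor_out_zeros:
  fixes f :: "complex \<Rightarrow> complex"
  assumes f: "f holomorphic_on S" and S: "open S" "connected S"
    and nz: "\<exists>w\<in>S. f w \<noteq> 0" and A: "finite A" "A \<subseteq> S"
  shows "\<exists>h. h holomorphic_on S \<and>
           (\<forall>w\<in>S. f w = (\<Prod>a\<in>A. (w - a) ^ nat (zorder f a)) * h w)"
  using A
proof (induction A rule: finite_induct)
  case empty
  then show ?case using f by auto
next
  case (insert a A)
  then obtain h where h: "h holomorphic_on S"
    and fh: "\<And>w. w \<in> S \<Longrightarrow> f w = (\<Prod>a\<in>A. (w - a) ^ nat (zorder f a)) * h w"
    by auto
  define p where "p w = (\<Prod>a\<in>A. (w - a) ^ nat (zorder f a))" for w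
  have p: "p holomorphic_on T" for T
    unfolding p_def by (intro holomorphic_intros)
  have pa: "p a \<noteq> 0" using insert by (auto simp: p_def)
  have aS: "a \<in> S" using insert by simp
  have nzh: "\<exists>w\<in>S. h w \<noteq> 0" using nz fh by auto
  define n where "n = zorder h a"
  define g where "g = zor_poly h a"
  from zorder_exist_zero[OF h S aS nzh] obtain r where n: "n \<ge> 0" and r: "r > 0" "cball a r \<subseteq> S"
    and g: "g holomorphic_on cball a r" and hg: "\<And>w. w \<in> cball a r \<Longrightarrow> h w = g w * (w - a) ^ nat n \<and> g w \<noteq> 0"
    unfolding n_def g_def by (metis order.strict_implies_order order_refl)
  \<comment> \<open>The factors already extracted do not vanish at \<open>a\<close>, so the order of
    \<open>f\<close> at \<open>a\<close> is that of the remaining factor \<open>h\<close>.\<close>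
  have zf: "zorder f a = n"
  proof (rule zorder_eqI[of "ball a r" a "\<lambda>w. p w * g w"])
    show "(\<lambda>w. p w * g w) holomorphic_on ball a r"
      by (intro holomorphic_intros p holomorphic_on_subset[OF g]) auto
    show "p a * g a \<noteq> 0" using pa hg[of a] r by auto
    show "f w = p w * g w * (w - a) powi n" if "w \<in> ball a r" "w \<noteq> a" for w
    proof -
      have "w \<in> S" using that r(2) by auto
      then show ?thesis using fh[of w] hg[of w] that n by (auto simp: p_def power_int_def)
    qed
  qed (use r in auto)
  \<comment> \<open>At \<open>a\<close> the quotient takes the value of the local nonvanishing
    factor \<open>g\<close>; it agrees with \<open>g\<close> on the ball and with the plain quotient
    elsewhere, so the two holomorphic pieces glue.\<close>
  define h2 where "h2 w = (if w = a then g a else h w / (w - a) ^ nat n)" for w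
  have "h2 holomorphic_on (S - {a}) \<union> ball a r"
  proof (rule holomorphic_on_Un)
    have "(\<lambda>w. h w / (w - a) ^ nat n) holomorphic_on S - {a}"
      by (intro holomorphic_intros holomorphic_on_subset[OF h]) auto
    then show "h2 holomorphic_on S - {a}"
      by (rule holomorphic_transform) (auto simp: h2_def)
    show "h2 holomorphic_on ball a r"
      by (rule holomorphic_transform[OF holomorphic_on_subset[OF g]]) (use hg in \<open>auto simp: h2_def\<close>)
    show "open (S - {a})" using S by (auto simp: open_Diff)
  qed auto
  moreover have "(S - {a}) \<union> ball a r = S" using r aS by auto
  ultimately have "h2 holomorphic_on S" by simp
  moreover have "f w = (\<Prod>a\<in>insert a A. (w - a) ^ nat (zorder f a)) * h2 w" if "w \<in> S" for w
  proof -
    have "h w = (w - a) ^ nat n * h2 w"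
      using hg[of a] r by (auto simp: h2_def)
    then show ?thesis using fh[OF that] insert zf by (simp add: mult_ac)
  qed
  ultimately show ?case by blast
qed

text \<open>A variant of Jensen's inequality. For zeros \<open>a\<close> in the disc of radius
  \<open>r\<close>, \<open>norm (w - a) \<ge> 4 * r\<close> on the circle of radius
  \<open>5 * r\<close>, while \<open>norm (q - a) \<le> 2 * r\<close>. The maximum principle for
  \<open>f\<close> with the zeros divided out thus yields a factor \<open>1/2\<close> at
  \<open>q\<close> for each zero, counted with multiplicity.\<close>

lemma zero_count_growth_bound:
  fixes f :: "complex \<Rightarrow> complex"
  assumes f: "f holomorphic_on ball 0 R" and r: "0 < r" "5 * r < R"
    and M: "\<And>w. w \<in> ball 0 R \<Longrightarrow> norm (f w) \<le> M"
    and q: "q \<in> cball 0 r" "f q \<noteq> 0" and A: "finite A" "A \<subseteq> cball 0 r"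
  shows "norm (f q) \<le> M * (1/2) ^ (\<Sum>a\<in>A. nat (zorder f a))"
proof -
  define N where "N = (\<Sum>a\<in>A. nat (zorder f a))"
  have "A \<subseteq> ball 0 R" "q \<in> ball 0 R" using A q r by auto
  with holomorphic_factor_out_zeros[OF f _ _ _ A(1)] q(2) obtain h
    where h: "h holomorphic_on ball 0 R"
      and fh: "\<And>w. w \<in> ball 0 R \<Longrightarrow> f w = (\<Prod>a\<in>A. (w - a) ^ nat (zorder f a)) * h w"
    by (metis open_ball connected_ball)
  have "norm (h q) \<le> M / (4 * r) ^ N"
  proof (rule maximum_modulus_frontier[of h "cball 0 (5 * r)"])
    have sub: "cball 0 (5 * r) \<subseteq> ball (0::complex) R" using r by auto
    show "h holomorphic_on interior (cball 0 (5 * r))"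
      by (rule holomorphic_on_subset[OF h]) (use sub in auto)
    show "continuous_on (closure (cball 0 (5 * r))) h"
      using holomorphic_on_imp_continuous_on[OF h] sub by (auto intro: continuous_on_subset)
    show "norm (h w) \<le> M / (4 * r) ^ N" if "w \<in> frontier (cball 0 (5 * r))" for w
    proof -
      have w: "norm w = 5 * r" using that by simp
      have wR: "w \<in> ball 0 R" using w r by simp
      have "(4 * r) ^ N = (\<Prod>a\<in>A. (4 * r) ^ nat (zorder f a))"
        by (simp add: N_def power_sum)
      also have "\<dots> \<le> (\<Prod>a\<in>A. norm (w - a) ^ nat (zorder f a))"
      proof (intro prod_mono conjI power_mono)
        fix a assume "a \<in> A"
        then have "norm a \<le> r" using A by auto
        then show "4 * r \<le> norm (w - a)" using norm_triangle_ineq2[of w a] w by simp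
      qed (use r in auto)
      finally have "(4 * r) ^ N * norm (h w) \<le> norm (f w)"
        unfolding fh[OF wR] by (simp add: norm_mult prod_norm[symmetric] norm_power mult_right_mono)
      also have "\<dots> \<le> M" using M[OF wR] .
      finally show ?thesis using r by (simp add: field_simps)
    qed
  qed (use q r in auto)
  moreover have "norm (f q) \<le> (2 * r) ^ N * norm (h q)"
  proof -
    have "(\<Prod>a\<in>A. norm (q - a) ^ nat (zorder f a)) \<le> (\<Prod>a\<in>A. (2 * r) ^ nat (zorder f a))"
    proof (intro prod_mono conjI power_mono)
      fix a assume "a \<in> A"
      then have "norm a \<le> r" using A by auto
      then show "norm (q - a) \<le> 2 * r" using norm_triangle_ineq4[of q a] q by simp
    qed auto
    also have "\<dots> = (2 * r) ^ N" by (simp add: N_def power_sum)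
    finally show ?thesis using fh[OF \<open>q \<in> ball 0 R\<close>]
      by (simp add: norm_mult prod_norm[symmetric] norm_power mult_right_mono)
  qed
  ultimately have "norm (f q) \<le> (2 * r) ^ N * (M / (4 * r) ^ N)"
    using r by (meson mult_left_mono order_trans zero_le_power zero_le_mult_iff less_imp_le zero_le_numeral)
  also have "\<dots> = M * ((2 * r) ^ N / (4 * r) ^ N)" by (simp only: times_divide_eq_right mult.commute)
  also have "\<dots> = M * (2 * r / (4 * r)) ^ N" by (simp only: power_divide)
  also have "\<dots> = M * (1/2) ^ N" using r by simp
  finally show ?thesis by (simp only: N_def)
qed

section \<open>The variable q = exp (2 \<pi> i z)\<close>

definition nome :: "complex \<Rightarrow> complex" where
  "nome z = exp (2 * of_real pi * \<i> * z)"

lemma norm_nome: "norm (nome z) = exp (- (2 * pi * Im z))"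
  by (simp add: nome_def)

lemma nome_nonzero [simp]: "nome z \<noteq> 0"
  by (simp add: nome_def)

lemma nome_eq_iff: "nome z = nome w \<longleftrightarrow> (\<exists>n::int. z = w + of_int n)"
proof -
  have "2 * of_real pi * \<i> * z = 2 * of_real pi * \<i> * w + complex_of_real (of_int (2 * n) * pi) * \<i>
      \<longleftrightarrow> z = w + of_int n" for n
  proof -
    have "2 * of_real pi * \<i> * w + complex_of_real (of_int (2 * n) * pi) * \<i> = 2 * of_real pi * \<i> * (w + of_int n)"
      by (simp add: algebra_simps)
    then show ?thesis by (simp only: mult_cancel_left) simp
  qed
  then show ?thesis unfolding nome_def exp_eq by simp
qed

lemma holomorphic_nome: "nome holomorphic_on A"
  unfolding nome_def[abs_def] by (intro holomorphic_intros)

lemma nome_Ln: "w \<noteq> 0 \<Longrightarrow> nome (Ln w / (2 * of_real pi * \<i>)) = w"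
  by (simp add: nome_def)

lemma periodic_of_int:
  fixes f :: "complex \<Rightarrow> complex"
  assumes per: "\<And>z. Im z > h \<Longrightarrow> f (z + 1) = f z" and z: "Im z > h"
  shows "f (z + of_int n) = f z"
proof (induction n rule: int_induct[where k = 0])
  case (step1 i)
  then show ?case using per[of "z + of_int i"] z by (simp add: add_ac)
next
  case (step2 i)
  then show ?case using per[of "z + of_int (i - 1)"] z by (simp add: algebra_simps)
qed simp

text \<open>Choose any logarithm and apply \<open>f\<close>: by periodicity the result is
  independent of the branch, so it is holomorphic on the punctured disc. Being bounded, it extends
  over the origin by Riemann's theorem, and the bound passes to the origin by continuity.\<close>

lemma periodic_factors_through_nome:
  fixes f :: "complex \<Rightarrow> complex"
  assumes f: "f holomorphic_on {z. Im z > h}"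
    and per: "\<And>z. Im z > h \<Longrightarrow> f (z + 1) = f z"
    and M: "\<And>z. Im z > h \<Longrightarrow> norm (f z) \<le> M"
  shows "\<exists>g. g holomorphic_on ball 0 (exp (- (2 * pi * h))) \<and>
    (\<forall>z. Im z > h \<longrightarrow> g (nome z) = f z) \<and> (\<forall>w\<in>ball 0 (exp (- (2 * pi * h))). norm (g w) \<le> M)"
proof -
  define R where "R = exp (- (2 * pi * h))"
  define g0 where "g0 w = f (Ln w / (2 * of_real pi * \<i>))" for w
  have Im_gt: "Im z > h" if "norm (nome z) < R" for z
    using that by (simp add: norm_nome R_def)
  have nome_less: "nome z \<in> ball 0 R - {0}" if "Im z > h" for z
    using that by (simp add: norm_nome R_def)
  have g0: "g0 (nome z) = f z" if z: "Im z > h" for z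
  proof -
    have "nome (Ln (nome z) / (2 * of_real pi * \<i>)) = nome z" by (rule nome_Ln) simp
    then obtain n where "Ln (nome z) / (2 * of_real pi * \<i>) = z + of_int n"
      unfolding nome_eq_iff by blast
    then show ?thesis using periodic_of_int[of h f z n, OF per z] by (simp add: g0_def)
  qed
  have g0M: "norm (g0 w) \<le> M" if "w \<in> ball 0 R - {0}" for w
    using that nome_Ln[of w] Im_gt[of "Ln w / (2 * of_real pi * \<i>)"] M unfolding g0_def by simp
  have "\<exists>e>0. g0 holomorphic_on ball w0 e" if w0: "w0 \<in> ball 0 R - {0}" for w0
  proof -
    have "open (ball 0 R - {0::complex})" by (simp add: open_Diff)
    then obtain e0 where e0: "e0 > 0" "ball w0 e0 \<subseteq> ball 0 R - {0}" using w0 openE by blast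
    \<comment> \<open>For \<open>w\<close> within \<open>norm w0\<close> of \<open>w0\<close> the
      quotient \<open>w / w0\<close> has positive real part, so \<open>L\<close> below is a
      holomorphic branch of the logarithm near \<open>w0\<close>, even when \<open>w0\<close> lies
      on the cut of \<open>Ln\<close>.\<close>
    define e where "e = min e0 (norm w0)"
    have e: "e > 0" using e0 w0 by (simp add: e_def)
    define L where "L w = (Ln (w / w0) + Ln w0) / (2 * of_real pi * \<i>)" for w
    have nz: "w / w0 \<notin> \<real>\<^sub>\<le>\<^sub>0" if "w \<in> ball w0 e" for w
    proof
      assume "w / w0 \<in> \<real>\<^sub>\<le>\<^sub>0"
      then have "Re (w / w0) \<le> 0" by (auto simp: nonpos_Reals_def)
      moreover have "norm (w / w0 - 1) < 1"
        using that w0 by (simp add: e_def dist_norm norm_minus_commute norm_divide diff_divide_eq_iff)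
      then have "\<bar>Re (w / w0 - 1)\<bar> < 1" using abs_Re_le_cmod le_less_trans by blast
      ultimately show False by simp
    qed
    have nL: "nome (L w) = w" if "w \<in> ball w0 e" for w
    proof -
      have "w \<noteq> 0" using nz[OF that] by auto
      then show ?thesis using w0 by (simp add: nome_def L_def exp_add)
    qed
    have sub: "ball w0 e \<subseteq> ball 0 R" using e0 by (auto simp: e_def)
    have LIm: "Im (L w) > h" if "w \<in> ball w0 e" for w
      using Im_gt[of "L w"] nL[OF that] that sub by auto
    have L: "L holomorphic_on ball w0 e"
      unfolding L_def using nz w0 by (intro holomorphic_intros) auto
    have "f \<circ> L holomorphic_on ball w0 e"
      by (rule holomorphic_on_compose_gen[OF L f]) (use LIm in auto)
    then have "g0 holomorphic_on ball w0 e"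
      by (rule holomorphic_transform) (metis LIm g0 nL o_apply)
    then show ?thesis using e by blast
  qed
  then have "g0 analytic_on ball 0 R - {0}" by (simp add: analytic_on_def)
  then have g0_hol: "g0 holomorphic_on ball 0 R - {0}" by (rule analytic_imp_holomorphic)
  have R: "R > 0" by (simp add: R_def)
  have ev: "eventually (\<lambda>w. norm (g0 w) \<le> M) (at 0)"
    unfolding eventually_at using R g0M by (intro exI[of _ R]) auto
  then obtain g where g: "g holomorphic_on ball 0 R" and gg0: "\<And>w. w \<in> ball 0 R - {0} \<Longrightarrow> g w = g0 w"
    using holomorphic_on_extend_bounded[OF g0_hol] R by auto
  have "norm (g w) \<le> M" if w: "w \<in> ball 0 R" for w
  proof (cases "w = 0")
    case True
    have "isCont g 0"
      using holomorphic_on_imp_continuous_on[OF g] R by (simp add: continuous_on_eq_continuous_at)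
    then have "((\<lambda>w. norm (g w)) \<longlongrightarrow> norm (g 0)) (at 0)" by (intro tendsto_norm) (simp add: isCont_def)
    moreover have "eventually (\<lambda>w. norm (g w) \<le> M) (at 0)"
      unfolding eventually_at using R g0M gg0 by (intro exI[of _ R]) auto
    ultimately show ?thesis unfolding True by (intro tendsto_upperbound) auto
  qed (use gg0 g0M w in auto)
  moreover have "g (nome z) = f z" if "Im z > h" for z
    using gg0[OF nome_less[OF that]] g0[OF that] by simp
  ultimately show ?thesis using g unfolding R_def by blast
qed

text \<open>The derivative of \<open>nome\<close> vanishes nowhere, so composition with it preserves
  orders. The point \<open>w\<close> certifies that \<open>g\<close> is not identically
  zero.\<close>

lemma zorder_compose_nome:
  assumes g: "g holomorphic_on ball 0 R" and z: "nome z \<in> ball 0 R" and nz: "w \<in> ball 0 R" "g w \<noteq> 0"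
    and fg: "eventually (\<lambda>z. f z = g (nome z)) (at z)"
  shows "zorder f z = zorder g (nome z)"
proof -
  have ana: "g analytic_on {nome z}"
    using g z analytic_at open_ball by blast
  have "zorder f z = zorder (g \<circ> nome) z"
    by (rule zorder_cong) (use fg in \<open>auto simp: o_def\<close>)
  also have "\<dots> = zorder g (nome z) * zorder (\<lambda>x. nome x - nome z) z"
  proof (rule zorder_compose')
    show "isolated_singularity_at g (nome z)" "not_essential g (nome z)"
      using ana isolated_singularity_at_analytic not_essential_analytic by blast+
    show "nome analytic_on {z}"
      using holomorphic_nome[of UNIV] analytic_at by blast
    show "\<forall>\<^sub>F w in at (nome z). g w \<noteq> 0"
      using non_zero_neighbour_alt[OF g _ _ z nz] by (auto elim: eventually_mono)
    \<comment> \<open>A shift by \<open>1/2\<close> changes the sign of \<open>nome\<close>; this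
      witnesses that \<open>nome\<close> is not constant.\<close>
    have "nome (z + 1/2) - nome z \<noteq> 0"
    proof -
      have "nome (z + 1/2) = - nome z"
        by (simp add: nome_def distrib_left exp_add exp_pi_i')
      then show ?thesis by simp
    qed
    then show "\<forall>\<^sub>F w in at z. nome w \<noteq> nome z"
      using non_zero_neighbour_alt[of "\<lambda>w. nome w - nome z" UNIV z "z + 1/2"]
        holomorphic_on_diff[OF holomorphic_nome[of UNIV] holomorphic_on_const, of "nome z"] connected_UNIV
      by auto
  qed
  also have "zorder (\<lambda>x. nome x - nome z) z = 1"
  proof (rule zorder_zero_eqI[where S = UNIV])
    have "deriv (\<lambda>x. nome x - nome z) z = 2 * of_real pi * \<i> * nome z"
      unfolding nome_def by (rule DERIV_imp_deriv) (auto intro!: derivative_eq_intros)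
    then show "(deriv ^^ nat 1) (\<lambda>x. nome x - nome z) z \<noteq> 0" by simp
  qed (auto intro!: holomorphic_intros holomorphic_nome)
  finally show ?thesis by simp
qed

section \<open>Poincare series\<close>

definition coprime_pairs :: "(int \<times> int) set" where
  "coprime_pairs = {(c, d). coprime c d}"

lemma summable_on_int_inverse_square:
  "(\<lambda>n::int. 1 / (1 + (of_int n)\<^sup>2) :: real) summable_on UNIV"
proof -
  have "summable (\<lambda>n. 1 / (1 + (real n)\<^sup>2))"
  proof (rule summable_comparison_test'[OF inverse_power_summable[of 2], of 1])
    show "norm (1 / (1 + (real n)\<^sup>2)) \<le> inverse (real n ^ 2)" if "n \<ge> 1" for n
    proof -
      have "0 < (real n)\<^sup>2" using that by simp
      then show ?thesis unfolding inverse_eq_divide by (simp add: frac_le)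
    qed
  qed simp
  then have nat: "(\<lambda>n. 1 / (1 + (real n)\<^sup>2)) summable_on UNIV"
    by (subst summable_on_UNIV_nonneg_real_iff) auto
  have 1: "(\<lambda>n::int. 1 / (1 + (of_int n)\<^sup>2) :: real) summable_on range int"
    by (subst summable_on_reindex) (use nat in \<open>auto simp: o_def\<close>)
  have 2: "(\<lambda>n::int. 1 / (1 + (of_int n)\<^sup>2) :: real) summable_on range (\<lambda>n. - int n)"
    by (subst summable_on_reindex) (use nat in \<open>auto simp: o_def inj_def\<close>)
  have "UNIV = range int \<union> range (\<lambda>n. - int n)"
    by (auto simp: image_iff) (metis int_cases2)
  then show ?thesis using summable_on_union[OF 1 2] by simp
qed

lemma coprime_square_sum_ge_1:
  assumes "coprime c (d::int)"
  shows "(1::real) \<le> (of_int c)\<^sup>2 + (of_int d)\<^sup>2"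
proof -
  have "c \<noteq> 0 \<or> d \<noteq> 0" using assms by auto
  then have "0 < c\<^sup>2 + d\<^sup>2" by (simp add: sum_power2_gt_zero_iff)
  then have "1 \<le> c\<^sup>2 + d\<^sup>2" by simp
  then have "real_of_int 1 \<le> of_int (c\<^sup>2 + d\<^sup>2)" by (rule of_int_le_iff[THEN iffD2])
  then show ?thesis by simp
qed

text \<open>With \<open>s = c^2\<close>, \<open>t = d^2\<close> and \<open>s + t \<ge> 1\<close> one
  has \<open>(1 + s) * (1 + t) \<le> 3 * (s + t)^2\<close>, so the double series is dominated by a
  product of two convergent simple series.\<close>

lemma summable_on_coprime_pairs:
  "(\<lambda>(c, d). 1 / ((of_int c)\<^sup>2 + (of_int d)\<^sup>2)\<^sup>2 :: real) summable_on coprime_pairs"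
proof -
  let ?u = "\<lambda>n::int. 1 / (1 + (of_int n)\<^sup>2) :: real"
  have "(\<lambda>(c, d). 3 * (?u c * ?u d)) summable_on UNIV \<times> UNIV"
  proof (rule summable_on_SigmaI[where g = "\<lambda>c. 3 * (?u c * infsum ?u UNIV)"])
    show "((\<lambda>y. case (x, y) of (c, d) \<Rightarrow> 3 * (?u c * ?u d)) has_sum 3 * (?u x * infsum ?u UNIV)) UNIV" for x
      using has_sum_cmult_right[OF has_sum_infsum[OF summable_on_int_inverse_square], of "3 * ?u x"]
      by simp
    show "(\<lambda>c. 3 * (?u c * infsum ?u UNIV)) summable_on UNIV"
      using summable_on_cmult_left[OF summable_on_int_inverse_square, of "3 * infsum ?u UNIV"]
      by (simp add: mult_ac)
  qed auto
  then have "(\<lambda>(c, d). 3 * (?u c * ?u d)) summable_on coprime_pairs"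
    by (rule summable_on_subset) auto
  then show ?thesis
  proof (rule summable_on_comparison_test)
    fix x assume "x \<in> coprime_pairs"
    then obtain c d where x: "x = (c, d)" "coprime c d" by (auto simp: coprime_pairs_def)
    define s t where "s = (real_of_int c)\<^sup>2" and "t = (real_of_int d)\<^sup>2"
    have st: "s \<ge> 0" "t \<ge> 0" "s + t \<ge> 1"
      using coprime_square_sum_ge_1[OF x(2)] by (auto simp: s_def t_def)
    have "(1 + s) * (1 + t) = 1 + (s + t) + s * t" by (simp add: algebra_simps)
    also have "\<dots> \<le> (s + t)\<^sup>2 + (s + t)\<^sup>2 + (s + t)\<^sup>2"
    proof (intro add_mono)
      show "1 \<le> (s + t)\<^sup>2" using st by (simp add: one_le_power)
      show "s + t \<le> (s + t)\<^sup>2" using st by (simp add: self_le_power)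
      show "s * t \<le> (s + t)\<^sup>2" using st by (simp add: power2_eq_square algebra_simps)
    qed
    finally have "(1 + s) * (1 + t) \<le> 3 * (s + t)\<^sup>2" by simp
    then have "1 / (s + t)\<^sup>2 \<le> 3 * (1 / (1 + s) * (1 / (1 + t)))"
      using st by (simp add: divide_simps)
    then show "(case x of (c, d) \<Rightarrow> 1 / ((of_int c)\<^sup>2 + (of_int d)\<^sup>2)\<^sup>2)
        \<le> (case x of (c, d) \<Rightarrow> 3 * (?u c * ?u d))"
      by (simp add: x s_def t_def)
  qed auto
qed

section \<open>Size of the terms and holomorphy of the series\<close>

lemma Im_fractional_linear:
  assumes "a * d - b * c = 1"
  shows "Im (fractional_linear a b c d z) = Im z / (norm (of_int c * z + of_int d))\<^sup>2"
proof -
  \<comment> \<open>Multiplying the numerator by the conjugate denominator leaves the determinant as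
    coefficient of \<open>Im z\<close>.\<close>
  have "Im z * (of_int (a * d - b * c)) = Im ((of_int a * z + of_int b) * cnj (of_int c * z + of_int d))"
    by (simp add: algebra_simps)
  then show ?thesis
    using assms by (simp add: fractional_linear_def Im_divide cmod_power2 algebra_simps)
qed

lemma coprime_denominator_nonzero:
  assumes "z \<in> upper_half_plane" "coprime c d"
  shows "of_int c * z + of_int d \<noteq> 0"
proof
  assume h: "of_int c * z + of_int d = 0"
  then have "Im (of_int c * z + of_int d) = 0" by simp
  then have "c = 0" using assms by (simp add: upper_half_plane_def)
  with h assms(2) show False by simp
qed

lemma top_rowE:
  assumes "coprime c (d::int)"
  obtains a b where "a * d - b * c = 1"
proof -
  obtain a b where "top_row c d = (a, b)" by fastforce
  with top_row_det[OF assms] that show ?thesis by blast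
qed

lemma norm_poincare_term:
  assumes "z \<in> upper_half_plane" "coprime c d"
  shows "norm (poincare_term k m z c d) =
    exp (- (2 * pi * m * Im z / (norm (of_int c * z + of_int d))\<^sup>2)) / norm (of_int c * z + of_int d) ^ k"
proof -
  obtain a b where det: "a * d - b * c = 1" using top_rowE[OF assms(2)] .
  show ?thesis
    unfolding poincare_term_eq[OF assms(1) det]
    using Im_fractional_linear[OF det, of z] by (simp add: norm_divide norm_power)
qed

text \<open>Uniform comparison of \<open>norm (c z + d)\<close> with the form at
  \<open>z = i\<close>: \<open>d\<close> is controlled by the real part of \<open>c z + d\<close>
  and by \<open>c\<close>, and \<open>c\<close> by the imaginary part, as
  \<open>Im z \<ge> 1/2\<close>.\<close>

lemma square_sum_le_norm_denominator:
  assumes "Im z \<ge> 1/2" "\<bar>Re z\<bar> \<le> B"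
  shows "(of_int c)\<^sup>2 + (of_int d)\<^sup>2 \<le> (8 * B\<^sup>2 + 4) * (norm (of_int c * z + of_int d))\<^sup>2"
proof -
  define x y p q where "x = Re z" and "y = Im z" and "p = real_of_int c" and "q = real_of_int d"
  have n: "(norm (of_int c * z + of_int d))\<^sup>2 = (p * x + q)\<^sup>2 + (p * y)\<^sup>2"
    unfolding cmod_power2 by (simp add: x_def y_def p_def q_def)
  have "q\<^sup>2 \<le> 2 * (p * x + q)\<^sup>2 + 2 * (p * x)\<^sup>2"
    using zero_le_power2[of "(p * x + q) + p * x"] by (simp add: power2_eq_square algebra_simps)
  moreover have "x\<^sup>2 \<le> B\<^sup>2" using assms(2) by (metis abs_ge_zero power2_abs power_mono x_def)
  then have "(p * x)\<^sup>2 \<le> p\<^sup>2 * B\<^sup>2" by (simp add: power_mult_distrib mult_left_mono)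
  ultimately have 1: "p\<^sup>2 + q\<^sup>2 \<le> 2 * (p * x + q)\<^sup>2 + (2 * B\<^sup>2 + 1) * p\<^sup>2" by (simp add: algebra_simps)
  have "(1/2)\<^sup>2 \<le> y\<^sup>2" using assms(1) by (intro power_mono) (auto simp: y_def)
  then have "p\<^sup>2 * (1/2)\<^sup>2 \<le> p\<^sup>2 * y\<^sup>2" by (intro mult_left_mono) auto
  then have "p\<^sup>2 \<le> 4 * (p * y)\<^sup>2" by (simp add: power_mult_distrib power_divide)
  then have 2: "(2 * B\<^sup>2 + 1) * p\<^sup>2 \<le> (2 * B\<^sup>2 + 1) * (4 * (p * y)\<^sup>2)" by (intro mult_left_mono) auto
  have 3: "2 * (p * x + q)\<^sup>2 \<le> (8 * B\<^sup>2 + 4) * (p * x + q)\<^sup>2" by (intro mult_right_mono) auto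
  have "p\<^sup>2 + q\<^sup>2 \<le> (8 * B\<^sup>2 + 4) * (p * x + q)\<^sup>2 + (2 * B\<^sup>2 + 1) * (4 * (p * y)\<^sup>2)"
    using 1 2 3 by linarith
  also have "\<dots> = (8 * B\<^sup>2 + 4) * ((p * x + q)\<^sup>2 + (p * y)\<^sup>2)" by algebra
  finally show ?thesis unfolding n by (simp add: p_def q_def)
qed

text \<open>The exponential factor is at most 1. For \<open>k \<ge> 4\<close> two powers of
  \<open>c^2 + d^2\<close> are retained, which is enough for summability; the price is a constant
  that grows only exponentially in \<open>k\<close>.\<close>

lemma norm_poincare_term_le:
  assumes z: "Im z \<ge> 1/2" "\<bar>Re z\<bar> \<le> B" and cd: "coprime c d" and k: "even k" "k \<ge> 4"
  shows "norm (poincare_term k m z c d)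
    \<le> (8 * B\<^sup>2 + 4) ^ (k div 2) * (1 / ((of_int c)\<^sup>2 + (of_int d)\<^sup>2)\<^sup>2)"
proof -
  have zH: "z \<in> upper_half_plane" using z by (simp add: upper_half_plane_def)
  define n s K where "n = norm (of_int c * z + of_int d)"
    and "s = (real_of_int c)\<^sup>2 + (of_int d)\<^sup>2" and "K = 8 * B\<^sup>2 + 4"
  obtain l where l: "k = 2 * l" using k by auto
  have n: "n > 0" using coprime_denominator_nonzero[OF zH cd] by (simp add: n_def)
  have s: "s \<ge> 1" using coprime_square_sum_ge_1[OF cd] by (simp add: s_def)
  have "s\<^sup>2 \<le> s ^ l" using s k l by (intro power_increasing) auto
  also have "\<dots> \<le> (K * n\<^sup>2) ^ l"
    using square_sum_le_norm_denominator[OF z, of c d] s by (intro power_mono) (auto simp: s_def n_def K_def)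
  also have "\<dots> = K ^ l * n ^ k" by (simp add: l power_mult_distrib power_mult)
  finally have *: "s\<^sup>2 \<le> K ^ l * n ^ k" .
  have "norm (poincare_term k m z c d) \<le> 1 / n ^ k"
    unfolding norm_poincare_term[OF zH cd] n_def[symmetric]
    using z n by (intro divide_right_mono) auto
  also have "\<dots> \<le> K ^ l * (1 / s\<^sup>2)"
    using * n s by (simp add: field_simps)
  finally show ?thesis by (simp add: s_def K_def l)
qed

lemma poincare_series_altdef:
  "poincare_series k m z = 1 / 2 * (\<Sum>\<^sub>\<infinity>(c, d)\<in>coprime_pairs. poincare_term k m z c d)"
  by (simp add: poincare_series_def coprime_pairs_def)

text \<open>Up to normalization the real-analytic Eisenstein series at \<open>z = i\<close>,
  \<open>s = 2\<close>; it does not depend on \<open>k\<close>, \<open>m\<close> or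
  \<open>z\<close>.\<close>

definition eisenstein_bound :: real where
  "eisenstein_bound = (\<Sum>\<^sub>\<infinity>(c, d)\<in>coprime_pairs. 1 / ((of_int c)\<^sup>2 + (of_int d)\<^sup>2)\<^sup>2)"

lemma eisenstein_bound_nonneg: "eisenstein_bound \<ge> 0"
  unfolding eisenstein_bound_def by (intro infsum_nonneg) auto

lemma summable_on_poincare_term:
  assumes z: "Im z \<ge> 1/2" and k: "even k" "k \<ge> 4"
  shows "(\<lambda>(c, d). norm (poincare_term k m z c d)) summable_on coprime_pairs"
proof (rule summable_on_comparison_test)
  show "(\<lambda>x. (8 * \<bar>Re z\<bar>\<^sup>2 + 4) ^ (k div 2) * (case x of (c, d) \<Rightarrow> 1 / ((of_int c)\<^sup>2 + (of_int d)\<^sup>2)\<^sup>2))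
      summable_on coprime_pairs"
    by (intro summable_on_cmult_right summable_on_coprime_pairs)
next
  fix x assume "x \<in> coprime_pairs"
  then show "(case x of (c, d) \<Rightarrow> norm (poincare_term k m z c d))
    \<le> (8 * \<bar>Re z\<bar>\<^sup>2 + 4) ^ (k div 2) * (case x of (c, d) \<Rightarrow> 1 / ((of_int c)\<^sup>2 + (of_int d)\<^sup>2)\<^sup>2)"
    using norm_poincare_term_le[OF z order_refl _ k, of "fst x" "snd x" m]
    by (simp add: coprime_pairs_def case_prod_unfold)
qed (simp add: case_prod_unfold)

lemma summable_on_poincare_term':
  assumes z: "Im z \<ge> 1/2" and k: "even k" "k \<ge> 4"
  shows "(\<lambda>(c, d). poincare_term k m z c d) summable_on coprime_pairs"
  by (rule abs_summable_summable) (use summable_on_poincare_term[OF assms] in \<open>simp add: case_prod_unfold\<close>)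

lemma poincare_term_holomorphic:
  assumes cd: "coprime c d"
  shows "(\<lambda>z. poincare_term k m z c d) holomorphic_on upper_half_plane"
proof -
  obtain a b where det: "a * d - b * c = 1" using top_rowE[OF cd] .
  have "(\<lambda>z. exp (2 * of_real pi * \<i> * of_nat m * fractional_linear a b c d z)
          / (of_int c * z + of_int d) ^ k) holomorphic_on upper_half_plane"
    unfolding fractional_linear_def
    using coprime_denominator_nonzero[OF _ cd] by (intro holomorphic_intros) auto
  then show ?thesis
    by (rule holomorphic_transform) (simp add: poincare_term_eq[OF _ det])
qed

text \<open>Weierstrass test on closed discs, on which the real part is bounded by some
  \<open>B\<close> as \<open>norm_poincare_term_le\<close> requires. The half-plane
  \<open>Im z > 1/2\<close> contains the fundamental domain with room to spare.\<close>

lemma poincare_series_holomorphic: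
  assumes k: "even k" "k \<ge> 4"
  shows "poincare_series k m holomorphic_on {z. Im z > 1/2}"
proof -
  have opn: "open {z. Im z > 1/2}" by (rule open_halfspace_Im_gt)
  have "\<exists>r>0. poincare_series k m holomorphic_on ball z r" if z: "z \<in> {z. Im z > 1/2}" for z
  proof -
    obtain r where r: "r > 0" "cball z r \<subseteq> {z. Im z > 1/2}"
      using open_contains_cball_eq[OF opn] z by blast
    define B where "B = \<bar>Re z\<bar> + r"
    have B: "\<bar>Re w\<bar> \<le> B" if "w \<in> cball z r" for w
      using that abs_Re_le_cmod[of "z - w"] by (auto simp: B_def dist_norm)
    have U: "uniform_limit (cball z r) (\<lambda>X w. \<Sum>x\<in>X. (\<lambda>(c, d). poincare_term k m w c d) x)
       (\<lambda>w. \<Sum>\<^sub>\<infinity>x\<in>coprime_pairs. (\<lambda>(c, d). poincare_term k m w c d) x) (finite_subsets_at_top coprime_pairs)"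
    proof (rule Weierstrass_m_test_general)
      show "(\<lambda>x. (8 * B\<^sup>2 + 4) ^ (k div 2) * (case x of (c, d) \<Rightarrow> 1 / ((of_int c)\<^sup>2 + (of_int d)\<^sup>2)\<^sup>2))
          summable_on coprime_pairs"
        by (intro summable_on_cmult_right summable_on_coprime_pairs)
      show "norm (case x of (c, d) \<Rightarrow> poincare_term k m w c d)
         \<le> (8 * B\<^sup>2 + 4) ^ (k div 2) * (case x of (c, d) \<Rightarrow> 1 / ((of_int c)\<^sup>2 + (of_int d)\<^sup>2)\<^sup>2)"
        if x: "x \<in> coprime_pairs" and w: "w \<in> cball z r" for x w
      proof -
        have "Im w \<ge> 1/2" using r w by force
        then show ?thesis
          using norm_poincare_term_le[OF _ B[OF w] _ k] x by (auto simp: coprime_pairs_def)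
      qed
    qed
    have "(\<lambda>w. \<Sum>x\<in>X. (\<lambda>(c, d). poincare_term k m w c d) x) holomorphic_on cball z r"
      if "X \<subseteq> coprime_pairs" for X
    proof (intro holomorphic_on_sum)
      fix x assume "x \<in> X"
      then have "coprime (fst x) (snd x)" using that by (auto simp: coprime_pairs_def)
      from poincare_term_holomorphic[OF this, of k m]
      show "(\<lambda>w. case x of (c, d) \<Rightarrow> poincare_term k m w c d) holomorphic_on cball z r"
        unfolding case_prod_unfold
        by (rule holomorphic_on_subset) (use r in \<open>force simp: upper_half_plane_def\<close>)
    qed
    note hol = this
    have ev: "\<forall>\<^sub>F X in finite_subsets_at_top coprime_pairs.
        continuous_on (cball z r) (\<lambda>w. \<Sum>x\<in>X. (\<lambda>(c, d). poincare_term k m w c d) x) \<and>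
        (\<lambda>w. \<Sum>x\<in>X. (\<lambda>(c, d). poincare_term k m w c d) x) holomorphic_on ball z r"
      by (intro eventually_finite_subsets_at_top_weakI conjI)
         (auto intro!: holomorphic_on_imp_continuous_on hol intro: holomorphic_on_subset[OF hol])
    have "(\<lambda>w. \<Sum>\<^sub>\<infinity>x\<in>coprime_pairs. (\<lambda>(c, d). poincare_term k m w c d) x) holomorphic_on ball z r"
      by (rule holomorphic_uniform_limit[OF ev U]) auto
    then have "(\<lambda>w. 1/2 * (\<Sum>\<^sub>\<infinity>x\<in>coprime_pairs. (\<lambda>(c, d). poincare_term k m w c d) x)) holomorphic_on ball z r"
      by (intro holomorphic_intros)
    then show ?thesis using r unfolding poincare_series_altdef[abs_def] by auto
  qed
  then have "poincare_series k m analytic_on {z. Im z > 1/2}"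
    by (auto simp: analytic_on_def)
  then show ?thesis by (rule analytic_imp_holomorphic)
qed

text \<open>The case \<open>B = 1\<close> of the bound on terms, where
  \<open>8 * B^2 + 4 = 12\<close>.\<close>

lemma norm_poincare_series_le_strip:
  assumes z: "Im z \<ge> 1/2" "\<bar>Re z\<bar> \<le> 1" and k: "even k" "k \<ge> 4"
  shows "norm (poincare_series k m z) \<le> 12 ^ (k div 2) * eisenstein_bound"
proof -
  have "norm (\<Sum>\<^sub>\<infinity>(c, d)\<in>coprime_pairs. poincare_term k m z c d) \<le> 12 ^ (k div 2) * eisenstein_bound"
    unfolding eisenstein_bound_def
  proof (rule norm_infsum_le)
    show "((\<lambda>(c, d). poincare_term k m z c d) has_sum (\<Sum>\<^sub>\<infinity>(c, d)\<in>coprime_pairs. poincare_term k m z c d)) coprime_pairs"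
      using summable_on_poincare_term'[OF z(1) k] by (rule has_sum_infsum)
    show "((\<lambda>x. 12 ^ (k div 2) * (case x of (c, d) \<Rightarrow> 1 / ((of_int c)\<^sup>2 + (of_int d)\<^sup>2)\<^sup>2)) has_sum
      12 ^ (k div 2) * (\<Sum>\<^sub>\<infinity>(c, d)\<in>coprime_pairs. 1 / ((real_of_int c)\<^sup>2 + (of_int d)\<^sup>2)\<^sup>2)) coprime_pairs"
      by (intro has_sum_cmult_right has_sum_infsum summable_on_coprime_pairs)
    show "norm (case x of (c, d) \<Rightarrow> poincare_term k m z c d)
      \<le> 12 ^ (k div 2) * (case x of (c, d) \<Rightarrow> 1 / ((of_int c)\<^sup>2 + (of_int d)\<^sup>2)\<^sup>2)"
      if "x \<in> coprime_pairs" for x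
      using norm_poincare_term_le[OF z _ k] that by (auto simp: coprime_pairs_def)
  qed
  moreover have "norm (poincare_series k m z)
      \<le> norm (\<Sum>\<^sub>\<infinity>(c, d)\<in>coprime_pairs. poincare_term k m z c d)"
    unfolding poincare_series_altdef norm_mult by simp
  ultimately show ?thesis by linarith
qed

section \<open>Symmetries of the series\<close>

lemma poincare_series_plus_1:
  assumes z: "z \<in> upper_half_plane"
  shows "poincare_series k m (z + 1) = poincare_series k m z"
proof -
  have "(\<Sum>\<^sub>\<infinity>(c, d)\<in>coprime_pairs. poincare_term k m (z + 1) c d) =
        (\<Sum>\<^sub>\<infinity>(c, d)\<in>coprime_pairs. poincare_term k m z c d)"
  \<comment> \<open>Translating \<open>z\<close> by 1 multiplies the matrix on the right by the unit
    translation, which changes its rows to \<open>(a, a + b)\<close> and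
    \<open>(c, c + d)\<close>.\<close>
  proof (rule infsum_reindex_bij_witness[where j = "\<lambda>(c, d). (c, c + d)" and i = "\<lambda>(c, d). (c, d - c)"])
    fix x assume "x \<in> coprime_pairs"
    then obtain c d where x: "x = (c, d)" "coprime c d" by (auto simp: coprime_pairs_def)
    obtain a b where det: "a * d - b * c = 1" using top_rowE[OF x(2)] .
    have det': "a * (c + d) - (a + b) * c = 1" using det by (simp add: algebra_simps)
    have z1: "z + 1 \<in> upper_half_plane" using z by (simp add: upper_half_plane_def)
    show "(case (case x of (c, d) \<Rightarrow> (c, c + d)) of (c, d) \<Rightarrow> poincare_term k m z c d) =
        (case x of (c, d) \<Rightarrow> poincare_term k m (z + 1) c d)"
      unfolding x prod.case poincare_term_eq[OF z1 det] poincare_term_eq[OF z det'] fractional_linear_def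
      by (simp add: distrib_left add_ac)
  next
    have cop: "coprime c (c + d) \<longleftrightarrow> coprime c d" for c d :: int
      by (simp only: coprime_iff_gcd_eq_1 gcd_add2)
    have "coprime c (d - c) \<longleftrightarrow> coprime c d" for c d :: int
      using cop[of c "d - c"] by simp
    with cop show "(case x of (c, d) \<Rightarrow> (c, c + d)) \<in> coprime_pairs" "(case x of (c, d) \<Rightarrow> (c, d - c)) \<in> coprime_pairs"
      if "x \<in> coprime_pairs" for x :: "int \<times> int" using that by (auto simp: coprime_pairs_def)
  qed auto
  then show ?thesis by (simp add: poincare_series_altdef)
qed

text \<open>On the imaginary axis the matrix with rows \<open>(-a, b)\<close>,
  \<open>(c, -d)\<close> sends \<open>z\<close> to minus the conjugate of the image under the
  original matrix, and its denominator is minus the conjugate one; the sign disappears for even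
  \<open>k\<close>.\<close>

lemma poincare_term_cnj:
  assumes y: "y > 0" and cd: "coprime c d" and k: "even k"
  shows "poincare_term k m (of_real y * \<i>) c (- d) = cnj (poincare_term k m (of_real y * \<i>) c d)"
proof -
  obtain a b where det: "a * d - b * c = 1" using top_rowE[OF cd] .
  have det': "(-a) * (-d) - b * c = 1" using det by simp
  have H: "of_real y * \<i> \<in> upper_half_plane" using y by (simp add: upper_half_plane_def)
  have 1: "of_int c * (of_real y * \<i>) + of_int (-d) = - cnj (of_int c * (of_real y * \<i>) + of_int d)"
    by (simp add: complex_eq_iff)
  have 2: "of_int (-a) * (of_real y * \<i>) + of_int b = cnj (of_int a * (of_real y * \<i>) + of_int b)"
    by (simp add: complex_eq_iff)
  show ?thesis
    unfolding poincare_term_eq[OF H det] poincare_term_eq[OF H det'] fractional_linear_def 1 2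
    by (simp only: complex_cnj_divide complex_cnj_power exp_cnj complex_cnj_mult power_minus_even[OF k])
       (simp del: complex_cnj_add complex_cnj_diff)
qed

lemma poincare_term_uminus:
  assumes z: "z \<in> upper_half_plane" and cd: "coprime c d" and k: "even k"
  shows "poincare_term k m z (- c) (- d) = poincare_term k m z c d"
proof -
  obtain a b where det: "a * d - b * c = 1" using top_rowE[OF cd] .
  have det': "(-a) * (-d) - (-b) * (-c) = 1" using det by simp
  have 1: "of_int (-c) * z + of_int (-d) = - (of_int c * z + of_int d)" for c d
    by simp
  show ?thesis
    unfolding poincare_term_eq[OF z det] poincare_term_eq[OF z det'] fractional_linear_def 1
    by (simp only: minus_divide_divide power_minus_even[OF k])
qed

text \<open>The substitution \<open>d -> -d\<close> conjugates the terms. On the axis, zeros of the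
  real part are therefore zeros of the series.\<close>

lemma poincare_series_imaginary_axis_real:
  assumes y: "y > 0" and k: "even k"
  shows "poincare_series k m (of_real y * \<i>) \<in> \<real>"
proof -
  have "(\<Sum>\<^sub>\<infinity>(c, d)\<in>coprime_pairs. poincare_term k m (of_real y * \<i>) c d) =
        (\<Sum>\<^sub>\<infinity>x\<in>coprime_pairs. cnj (case x of (c, d) \<Rightarrow> poincare_term k m (of_real y * \<i>) c d))"
    by (rule infsum_reindex_bij_witness[where j = "\<lambda>(c, d). (c, - d)" and i = "\<lambda>(c, d). (c, - d)"])
       (simp_all add: coprime_pairs_def case_prod_unfold poincare_term_cnj[OF y _ k])
  then have "(\<Sum>\<^sub>\<infinity>(c, d)\<in>coprime_pairs. poincare_term k m (of_real y * \<i>) c d) \<in> \<real>"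
    unfolding infsum_cnj Reals_cnj_iff by (rule sym)
  then show ?thesis unfolding poincare_series_altdef by (intro Reals_mult) auto
qed

section \<open>Zeros in the fundamental domain\<close>

lemma fundamental_domainD:
  assumes "z \<in> fundamental_domain"
  shows "Im z \<ge> 43/50" "- 1/2 < Re z" "Re z \<le> 1/2"
proof -
  have *: "Im z > 0 \<and> norm z \<ge> 1 \<and> - 1/2 < Re z \<and> Re z \<le> 1/2"
  proof (cases "norm z > 1")
    case True
    then show ?thesis using assms by (auto simp: fundamental_domain_def upper_half_plane_def)
  next
    case False
    then have n: "norm z = 1" "Arg z \<in> {pi/3..pi/2}" "Im z > 0"
      using assms by (auto simp: fundamental_domain_def upper_half_plane_def)
    have "Re z = cos (Arg z)" using cos_Arg[of z] n by (cases "z = 0") auto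
    moreover have "cos (Arg z) \<le> cos (pi/3)" using n(2) by (intro cos_monotone_0_pi_le) auto
    moreover have "cos (pi/2) \<le> cos (Arg z)" using n(2) by (intro cos_monotone_0_pi_le) auto
    ultimately show ?thesis using n by (simp add: cos_60)
  qed
  then show "- 1/2 < Re z" "Re z \<le> 1/2" by auto
  have "(Re z)\<^sup>2 \<le> (1/2)\<^sup>2" using * by (intro power2_le_iff_abs_le[THEN iffD2]) auto
  moreover have "1 \<le> (norm z)\<^sup>2" using * by (simp add: one_le_power)
  \<comment> \<open>The constant \<open>43/50\<close> is a rational number just below
    \<open>sqrt 3 / 2\<close>, the least height of the domain's closure.\<close>
  ultimately have "(43/50)\<^sup>2 \<le> (Im z)\<^sup>2" unfolding cmod_power2 by (simp add: power2_eq_square)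
  then show "Im z \<ge> 43/50" using * by (simp add: power2_le_iff_abs_le)
qed

lemma imaginary_line_subset: "imaginary_line \<subseteq> fundamental_domain"
proof
  fix z assume "z \<in> imaginary_line"
  then obtain t where t: "z = of_real t * \<i>" "t \<ge> 1" by (auto simp: imaginary_line_def)
  have "Arg z = pi / 2" using t Arg_times_of_real[of t \<i>] by simp
  then show "z \<in> fundamental_domain"
    using t by (auto simp: fundamental_domain_def upper_half_plane_def norm_mult)
qed

lemma norm_poincare_series_le:
  assumes z: "Im z > 1/2" and k: "even k" "k \<ge> 4"
  shows "norm (poincare_series k m z) \<le> 12 ^ (k div 2) * eisenstein_bound"
proof -
  let ?w = "z - of_int \<lfloor>Re z\<rfloor>"
  have "poincare_series k m z = poincare_series k m (?w + of_int \<lfloor>Re z\<rfloor>)" by simp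
  also have "\<dots> = poincare_series k m ?w"
    by (rule periodic_of_int[of "1/2"])
       (use z in \<open>auto intro!: poincare_series_plus_1 simp: upper_half_plane_def\<close>)
  finally show ?thesis
    using norm_poincare_series_le_strip[OF _ _ k, of ?w m] z by (simp add: abs_le_iff) linarith
qed

text \<open>The condition \<open>5 * r < R\<close> of \<open>zero_count_growth_bound\<close> for the
  images under \<open>nome\<close> of the heights \<open>43/50\<close> and \<open>1/2\<close>. It
  holds because \<open>2 \<pi> (43/50 - 1/2) > 21/10\<close>, by \<open>\<pi> > 3\<close>, and
  \<open>exp (21/10) > 5\<close>.\<close>

lemma five_exp_less: "5 * exp (- (2 * pi * (43/50))) < exp (- (2 * pi * (1/2)))"
proof -
  have "5 < 1 + 21/10 + (21/10)\<^sup>2 / (2::real)" by (simp add: power2_eq_square)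
  also have "\<dots> \<le> exp (21/10 :: real)" by (rule exp_lower_Taylor_quadratic) simp
  also have "\<dots> \<le> exp (2 * pi * (43/50) - 2 * pi * (1/2))" using pi_gt3 by simp
  finally have "5 * exp (- (2 * pi * (43/50))) < exp (2 * pi * (43/50) - 2 * pi * (1/2)) * exp (- (2 * pi * (43/50)))"
    by (intro mult_strict_right_mono) auto
  then show ?thesis unfolding exp_add[symmetric] by simp
qed

text \<open>In the variable \<open>q\<close> the zeros in the fundamental domain become zeros of
  \<open>g\<close> in the disc of radius \<open>r\<close>, with the same orders, and
  \<open>i y\<close> maps to that disc as well. A lower bound for the series at \<open>i y\<close>
  thus limits the number of zeros.\<close>

lemma poincare_series_zero_count_le:
  assumes k: "even k" "k \<ge> 4" and y: "y \<ge> 1" and nz: "poincare_series k m (of_real y * \<i>) \<noteq> 0"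
  shows "finite (zeros_in (poincare_series k m) fundamental_domain)"
    and "norm (poincare_series k m (of_real y * \<i>)) \<le> 12 ^ (k div 2) * eisenstein_bound *
           (1/2) ^ nat (zero_count_mult (poincare_series k m) fundamental_domain)"
proof -
  define P where "P = poincare_series k m"
  define R r where "R = exp (- (2 * pi * (1/2)))" and "r = exp (- (2 * pi * (43/50)))"
  have r: "0 < r" "5 * r < R" using five_exp_less by (auto simp: R_def r_def)
  have hol: "P holomorphic_on {z. Im z > 1/2}"
    using poincare_series_holomorphic[OF k] by (simp add: P_def)
  have per: "P (z + 1) = P z" if "Im z > 1/2" for z
    unfolding P_def by (rule poincare_series_plus_1) (use that in \<open>simp add: upper_half_plane_def\<close>)
  obtain g where g: "g holomorphic_on ball 0 R" and gP: "\<And>z. Im z > 1/2 \<Longrightarrow> g (nome z) = P z"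
    and gM: "\<And>w. w \<in> ball 0 R \<Longrightarrow> norm (g w) \<le> 12 ^ (k div 2) * eisenstein_bound"
    using periodic_factors_through_nome[OF hol per] norm_poincare_series_le[OF _ k, of _ m]
    unfolding P_def R_def by metis
  define q where "q = nome (of_real y * \<i>)"
  have q: "q \<in> cball 0 r" using y by (simp add: q_def norm_nome r_def)
  have gq: "g q = P (of_real y * \<i>)" unfolding q_def using y by (intro gP) simp
  have gq0: "g q \<noteq> 0" using gq nz by (simp add: P_def)
  have sub: "cball 0 r \<subseteq> ball (0::complex) R" using r by auto
  define Z where "Z = zeros_in P fundamental_domain"
  have ZD: "Im z \<ge> 43/50" "- 1/2 < Re z" "Re z \<le> 1/2" "P z = 0" if "z \<in> Z" for z
    using that fundamental_domainD[of z] by (auto simp: Z_def zeros_in_def)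
  \<comment> \<open>Real parts lie in a half-open interval of length 1, so no two distinct points of
    \<open>Z\<close> differ by an integer.\<close>
  have inj: "inj_on nome Z"
  proof (rule inj_onI)
    fix z w assume zw: "z \<in> Z" "w \<in> Z" "nome z = nome w"
    then obtain n where n: "z = w + of_int n" by (auto simp: nome_eq_iff)
    then have "Re z = Re w + of_int n" by simp
    then have "of_int n < (1::real)" "-1 < (of_int n :: real)" using ZD[OF zw(1)] ZD[OF zw(2)] by linarith+
    then have "n = 0" by linarith
    then show "z = w" using n by simp
  qed
  have img: "nome ` Z \<subseteq> {w \<in> cball 0 r. g w = 0}"
    using ZD gP by (fastforce simp: norm_nome r_def)
  have fin0: "finite {w \<in> cball 0 r. g w = 0}"
  proof (cases "g constant_on ball 0 R")
    case True
    then obtain c where c: "\<And>w. w \<in> ball 0 R \<Longrightarrow> g w = c" by (auto simp: constant_on_def)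
    then have "g w = g q" if "w \<in> cball 0 r" for w using sub q that by (metis subsetD)
    then have "{w \<in> cball 0 r. g w = 0} = {}" using gq0 by auto
    then show ?thesis by (simp only: finite.emptyI)
  next
    case False
    then show ?thesis using holomorphic_compact_finite_zeros[OF g _ _ _ sub False] by simp
  qed
  have fin: "finite (nome ` Z)" using img fin0 finite_subset by blast
  then have finZ: "finite Z" using inj finite_imageD by blast
  then show "finite (zeros_in (poincare_series k m) fundamental_domain)" by (simp add: Z_def P_def)
  have zo: "zorder P z = zorder g (nome z)" if "z \<in> Z" for z
  proof (rule zorder_compose_nome[OF g])
    show "nome z \<in> ball 0 R" using img that sub by blast
    show "q \<in> ball 0 R" using q sub by blast
    have "eventually (\<lambda>z. z \<in> {z. Im z > 1/2}) (at z)"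
      by (rule eventually_at_in_open', rule open_halfspace_Im_gt) (use ZD[OF that] in auto)
    then show "eventually (\<lambda>z. P z = g (nome z)) (at z)"
      by eventually_elim (use gP in auto)
  qed (use gq0 in auto)
  have nonneg: "zorder g w \<ge> 0" if "w \<in> nome ` Z" for w
  proof -
    have "w \<in> ball 0 R" using img that sub by blast
    moreover have "q \<in> ball 0 R" using q sub by blast
    ultimately show ?thesis using zorder_exist_zero[OF g _ _ _ bexI[of _ q], of w] gq0
      by (auto split: if_splits)
  qed
  have "zero_count_mult P fundamental_domain = (\<Sum>z\<in>Z. zorder g (nome z))"
    unfolding zero_count_mult_def Z_def[symmetric] by (intro sum.cong zo refl)
  also have "\<dots> = (\<Sum>w\<in>nome ` Z. zorder g w)"
    using sum.reindex[OF inj, of "zorder g"] by simp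
  also have "\<dots> = int (\<Sum>w\<in>nome ` Z. nat (zorder g w))"
    unfolding of_nat_sum by (intro sum.cong refl) (use nonneg in auto)
  finally have cnt: "nat (zero_count_mult P fundamental_domain) = (\<Sum>w\<in>nome ` Z. nat (zorder g w))" by (simp only: nat_int)
  have "norm (g q) \<le> 12 ^ (k div 2) * eisenstein_bound * (1/2) ^ (\<Sum>w\<in>nome ` Z. nat (zorder g w))"
    by (rule zero_count_growth_bound[OF g r gM q gq0 fin]) (use img in auto)
  then show "norm (poincare_series k m (of_real y * \<i>)) \<le> 12 ^ (k div 2) * eisenstein_bound *
           (1/2) ^ nat (zero_count_mult (poincare_series k m) fundamental_domain)"
    using cnt gq by (simp add: P_def)
qed

section \<open>Oscillation on the imaginary axis\<close>

lemma norm_denominator_imaginary: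
  "(norm (of_int c * (of_real y * \<i>) + of_int d))\<^sup>2 = (of_int c)\<^sup>2 * y\<^sup>2 + (of_int d)\<^sup>2"
  unfolding cmod_power2 by (simp add: power_mult_distrib)

lemma norm_poincare_term_imaginary:
  assumes y: "y > 0" and cd: "coprime c d" and k: "k > 0"
  shows "norm (poincare_term k m (of_real y * \<i>) c d) = exp (- (real k * decay_rate (m / k) y c d))"
proof -
  have H: "of_real y * \<i> \<in> upper_half_plane" using y by (simp add: upper_half_plane_def)
  define n where "n = norm (of_int c * (of_real y * \<i>) + of_int d)"
  have n: "n > 0" using coprime_denominator_nonzero[OF H cd] by (simp add: n_def)
  have n2: "(of_int c)\<^sup>2 * y\<^sup>2 + (of_int d)\<^sup>2 = n\<^sup>2"
    unfolding n_def by (rule norm_denominator_imaginary[symmetric])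
  have "norm (poincare_term k m (of_real y * \<i>) c d) = exp (- (2 * pi * m * y / n\<^sup>2)) / n ^ k"
    unfolding norm_poincare_term[OF H cd] n_def[symmetric] by simp
  also have "n ^ k = exp (real k * ln n)" using n by (simp add: exp_of_nat_mult)
  also have "exp (- (2 * pi * m * y / n\<^sup>2)) / \<dots> = exp (- (2 * pi * m * y / n\<^sup>2) - real k * ln n)"
    by (simp add: exp_diff)
  also have "- (2 * pi * m * y / n\<^sup>2) - real k * ln n = - (real k * decay_rate (m / k) y c d)"
    unfolding decay_rate_def n2 using n k by (simp add: ln_realpow field_simps)
  finally show ?thesis .
qed

text \<open>All dependence of the argument on \<open>y\<close> is in \<open>phase_rate\<close>; the
  constant is \<open>\<theta> = 2 \<pi> m a / c\<close>.\<close>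

lemma poincare_term_polar:
  assumes c: "c > 0" and d: "d > 0" and cd: "coprime c d" and k: "k > 0"
  obtains \<theta> where "\<And>y. y > 0 \<Longrightarrow> Re (poincare_term k m (of_real y * \<i>) c d) =
      exp (- (real k * decay_rate (m / k) y c d)) * cos (real k * phase_rate (m / k) y c d + \<theta>)"
proof -
  obtain a b where det: "a * d - b * c = 1" using top_rowE[OF cd] .
  show thesis
  proof (rule that)
    fix y :: real assume y: "y > 0"
    define z where "z = of_real y * \<i>"
    have H: "z \<in> upper_half_plane" using y by (simp add: z_def upper_half_plane_def)
    define w where "w = of_int c * z + of_int d"
    have w0: "w \<noteq> 0" using coprime_denominator_nonzero[OF H cd] by (simp add: w_def)
    define t where "t = arctan (c * y / d)"
    define r where "r = (real_of_int c)\<^sup>2 * y\<^sup>2 + (of_int d)\<^sup>2"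
    have nw: "(norm w)\<^sup>2 = r" unfolding r_def w_def z_def by (rule norm_denominator_imaginary)
    have r: "r > 0" using w0 nw by (metis norm_eq_zero zero_less_power2)
    have "sqrt (1 + (c * y / d)\<^sup>2) = norm w / d"
    proof -
      have "1 + (c * y / d)\<^sup>2 = (norm w / d)\<^sup>2"
        using d by (simp add: power_divide nw r_def field_simps)
      then show ?thesis using d by simp
    qed
    \<comment> \<open>As \<open>d > 0\<close>, \<open>w\<close> lies in the right half-plane, where
      the arctangent is its argument.\<close>
    then have wpolar: "w = of_real (norm w) * cis t"
      using d w0 by (simp add: complex_eq_iff t_def cos_arctan sin_arctan) (simp add: w_def z_def)
    have "fractional_linear a b c d z = of_int a / of_int c - 1 / (of_int c * w)"
    proof -
      have "of_int a * w - 1 = of_int c * (of_int a * z + of_int b)"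
      proof -
        have "(1::complex) = of_int (a * d - b * c)" using det by simp
        then show ?thesis by (simp add: w_def algebra_simps)
      qed
      then have "of_int a * z + of_int b = (of_int a * w - 1) / of_int c" using c by (simp add: field_simps)
      then show ?thesis unfolding fractional_linear_def w_def[symmetric] using w0 by (simp add: diff_divide_distrib)
    qed
    moreover have "Re (1 / (of_int c * w)) = d / (c * r)"
    proof -
      have "Re (inverse w) = d / r"
        using nw by (simp add: cmod_power2 w_def z_def r_def)
      moreover have "1 / (of_int c * w) = inverse w / of_real (of_int c)" by (simp add: divide_inverse mult_ac)
      ultimately show ?thesis by (simp only: Re_divide_of_real) simp
    qed
    ultimately have Re: "Re (fractional_linear a b c d z) = a / c - d / (c * r)" by simp
    define X where "X = 2 * of_real pi * \<i> * of_nat m * fractional_linear a b c d z"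
    have ImX: "Im X = 2 * pi * m * (a / c - d / (c * r))" by (simp add: X_def Re)
    have "poincare_term k m z c d = exp X / w ^ k"
      unfolding poincare_term_eq[OF H det] X_def w_def ..
    also have "exp X = of_real (exp (Re X)) * cis (Im X)"
      by (simp add: exp_eq_polar)
    also have "w ^ k = of_real (norm w ^ k) * cis (real k * t)"
      by (subst wpolar) (simp add: power_mult_distrib Complex.DeMoivre)
    also have "of_real (exp (Re X)) * cis (Im X) / (of_real (norm w ^ k) * cis (real k * t)) =
        of_real (exp (Re X) / norm w ^ k) * cis (Im X - real k * t)"
      by (simp add: cis_divide[symmetric])
    finally have T: "poincare_term k m z c d = of_real (exp (Re X) / norm w ^ k) * cis (Im X - real k * t)" .
    then have "norm (poincare_term k m z c d) = exp (Re X) / norm w ^ k"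
      by (simp add: norm_mult norm_divide norm_power)
    then have "exp (Re X) / norm w ^ k = exp (- (real k * decay_rate (m / k) y c d))"
      using norm_poincare_term_imaginary[OF y cd k] by (simp add: z_def)
    moreover have "Im X - real k * t = real k * phase_rate (m / k) y c d + 2 * pi * m * a / c"
      unfolding ImX phase_rate_def t_def[symmetric] r_def[symmetric] using k
      by (simp add: algebra_simps)
    ultimately show "Re (poincare_term k m (of_real y * \<i>) c d) =
      exp (- (real k * decay_rate (m / k) y c d)) * cos (real k * phase_rate (m / k) y c d + 2 * pi * m * a / c)"
      using T by (simp add: z_def)
  qed
qed

text \<open>Where \<phi> equals \<open>j \<pi>\<close>, \<open>f\<close> has the sign of
  \<open>(-1)^j\<close>, so a zero lies between consecutive such points. Keeping the zeros strictly
  to the right of \<open>y0\<close> makes the zero added in the induction a new one;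
  \<open>y0\<close> is later also the point where the series is large.\<close>

lemma oscillation_zeros:
  fixes f \<rho> \<phi> :: "real \<Rightarrow> real" and n :: int
  assumes "continuous_on {a..b} f" "continuous_on {a..b} \<phi>" "a \<le> b"
    and "\<And>y. y \<in> {a..b} \<Longrightarrow> \<bar>f y - \<rho> y * cos (\<phi> y)\<bar> < \<rho> y"
    and "\<phi> a \<le> n * pi" "(n + int N) * pi \<le> \<phi> b"
  shows "\<exists>y0\<in>{a..b}. \<phi> y0 = n * pi \<and> (\<exists>Z. finite Z \<and> card Z = N \<and> Z \<subseteq> {y0<..b} \<and> (\<forall>y\<in>Z. f y = 0))"
  using assms
proof (induction N arbitrary: a n)
  case 0
  then obtain y0 where "a \<le> y0" "y0 \<le> b" "\<phi> y0 = n * pi"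
    using IVT'[of \<phi> a "n * pi" b] by auto
  then show ?case by (intro bexI[of _ y0] conjI exI[of _ "{}"]) auto
next
  case (Suc N)
  have "n * pi \<le> (n + int (Suc N)) * pi" by (intro mult_right_mono) auto
  then have "n * pi \<le> \<phi> b" using Suc.prems(6) by linarith
  then obtain y0 where y0: "a \<le> y0" "y0 \<le> b" "\<phi> y0 = n * pi"
    using IVT'[of \<phi> a "n * pi" b] Suc.prems(2,3,5) by auto
  have "\<exists>y1\<in>{y0..b}. \<phi> y1 = (n + 1) * pi \<and> (\<exists>Z. finite Z \<and> card Z = N \<and> Z \<subseteq> {y1<..b} \<and> (\<forall>y\<in>Z. f y = 0))"
  proof (rule Suc.IH)
    show "continuous_on {y0..b} f" "continuous_on {y0..b} \<phi>"
      using y0 by (auto intro: continuous_on_subset[OF Suc.prems(1)] continuous_on_subset[OF Suc.prems(2)])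
  qed (use Suc.prems y0 in \<open>auto simp: algebra_simps\<close>)
  then obtain y1 Z where y1: "y0 \<le> y1" "y1 \<le> b" "\<phi> y1 = (n + 1) * pi"
    and Z: "finite Z" "card Z = N" "Z \<subseteq> {y1<..b}" "\<forall>y\<in>Z. f y = 0"
    by auto
  have "y0 \<noteq> y1" using y0 y1 by auto
  have osc: "\<bar>f y0 - \<rho> y0 * cos (n * pi)\<bar> < \<rho> y0" "\<bar>f y1 + \<rho> y1 * cos (n * pi)\<bar> < \<rho> y1"
    using Suc.prems(4)[of y0] Suc.prems(4)[of y1] y0 y1 by (auto simp: distrib_right)
  have cf: "continuous_on {y0..y1} f"
    by (rule continuous_on_subset[OF Suc.prems(1)]) (use y0 y1 in auto)
  have sgn: "f y0 * f y1 < 0"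
  proof (cases "even n")
    case True
    then have "cos (n * pi) = 1" by (simp add: cos_npi_int mult.commute[of _ pi])
    then have "f y0 > 0" "f y1 < 0" using osc by auto
    then show ?thesis by (simp add: mult_less_0_iff)
  next
    case False
    then have "cos (n * pi) = -1" by (simp add: cos_npi_int mult.commute[of _ pi])
    then have "f y0 < 0" "f y1 > 0" using osc by auto
    then show ?thesis by (simp add: mult_less_0_iff)
  qed
  have "\<exists>x\<ge>y0. x \<le> y1 \<and> f x = 0"
  proof (cases "f y0 < 0")
    case True
    then show ?thesis using IVT'[OF _ _ y1(1) cf, of 0] sgn by (auto simp: mult_less_0_iff)
  next
    case False
    then show ?thesis using IVT2'[OF _ _ y1(1) cf, of 0] sgn by (auto simp: mult_less_0_iff)
  qed
  then obtain x where x: "y0 \<le> x" "x \<le> y1" "f x = 0" by blast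
  have "x \<noteq> y0" "x \<notin> Z" using x sgn Z(3) by auto
  then have "insert x Z \<subseteq> {y0<..b}" "card (insert x Z) = Suc N" using x y1 Z by (auto simp: subset_iff)
  then show ?case using y0 x Z by (intro bexI[of _ y0] conjI exI[of _ "insert x Z"]) auto
qed

text \<open>The four sign variants of \<open>(c, d)\<close> contribute \<open>2 * Re T\<close> after
  the factor \<open>1/2\<close>; all other terms are smaller by a factor exponential in
  \<delta>.\<close>

lemma poincare_series_dominated:
  assumes k: "even k" "k \<ge> 4" and y: "y \<ge> 1" and cd: "c > 0" "d > 0" "coprime c d"
    and dom: "\<And>c' d'. \<lbrakk>coprime c' d'; (\<bar>c'\<bar>, \<bar>d'\<bar>) \<noteq> (c, d)\<rbrakk>
       \<Longrightarrow> decay_rate (m / k) y c d + \<delta> \<le> decay_rate (m / k) y c' d'"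
  shows "\<bar>Re (poincare_series k m (of_real y * \<i>)) - 2 * Re (poincare_term k m (of_real y * \<i>) c d)\<bar>
    \<le> exp (- (real (k - 4) * (decay_rate (m / k) y c d + \<delta>))) * eisenstein_bound"
proof -
  define z where "z = of_real y * \<i>"
  have zH: "z \<in> upper_half_plane" and Imz: "Im z \<ge> 1/2"
    using y by (auto simp: z_def upper_half_plane_def)
  define f where "f = (\<lambda>(c, d). poincare_term k m z c d)"
  define T where "T = poincare_term k m z c d"
  define B where "B = {(c, d), (- c, - d), (c, - d), (- c, d)}"
  define A where "A = coprime_pairs - B"
  define W where "W = exp (- (real (k - 4) * (decay_rate (m / k) y c d + \<delta>)))"
  have sumf: "f summable_on coprime_pairs"
    unfolding f_def by (rule summable_on_poincare_term'[OF Imz k])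
  have BC: "B \<subseteq> coprime_pairs" using cd by (auto simp: B_def coprime_pairs_def)
  have finB: "finite B" by (simp add: B_def)
  have sumA: "f summable_on A" using sumf by (rule summable_on_subset) (auto simp: A_def)
  have "coprime_pairs = A \<union> B" using BC by (auto simp: A_def)
  then have split: "infsum f coprime_pairs = infsum f A + sum f B"
    using infsum_Un_disjoint[of f A B] sumA finB by (auto simp: A_def)
  have cnj: "poincare_term k m z c (- d) = cnj T"
    unfolding T_def z_def by (rule poincare_term_cnj) (use y cd k in auto)
  have "poincare_term k m z (- c) d = cnj T"
    using poincare_term_uminus[OF zH, of c "- d" k m] cd k cnj by simp
  moreover have "poincare_term k m z (- c) (- d) = T"
    unfolding T_def by (rule poincare_term_uminus[OF zH]) (use cd k in auto)
  ultimately have "sum f B = 2 * (T + cnj T)"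
    using cd cnj by (simp add: B_def f_def T_def[symmetric])
  also have "\<dots> = of_real (4 * Re T)" by (simp add: complex_add_cnj)
  finally have sumB: "sum f B = of_real (4 * Re T)" .
  have bound: "norm (f x) \<le> W * (case x of (c, d) \<Rightarrow> 1 / ((of_int c)\<^sup>2 + (of_int d)\<^sup>2)\<^sup>2)" if xA: "x \<in> A" for x
  proof -
    obtain c' d' where x: "x = (c', d')" by fastforce
    have cop: "coprime c' d'" using xA x by (auto simp: A_def coprime_pairs_def)
    have ne: "(\<bar>c'\<bar>, \<bar>d'\<bar>) \<noteq> (c, d)" using xA x by (auto simp: A_def B_def abs_if split: if_splits)
    define s where "s = (real_of_int c')\<^sup>2 + (of_int d')\<^sup>2"
    have s: "s \<ge> 1" unfolding s_def by (rule coprime_square_sum_ge_1[OF cop])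
    define G where "G = decay_rate (m / k) y c' d'"
    have Gs: "G \<ge> ln s / 2" unfolding G_def s_def by (rule decay_rate_ge) (use y s in \<open>auto simp: s_def\<close>)
    have "norm (f x) = exp (- (real k * G))"
      using norm_poincare_term_imaginary[OF _ cop, of y k m] y k by (simp add: f_def x z_def G_def)
    \<comment> \<open>The part \<open>exp (- 4 G)\<close> is at most \<open>1 / s^2\<close> and
      keeps the sum over pairs finite; the other \<open>k - 4\<close> copies of \<open>G\<close>
      carry the gain \<delta>.\<close>
    also have "\<dots> = exp (- (real (k - 4) * G)) * exp (- (4 * G))"
      using k unfolding exp_add[symmetric] by (simp add: of_nat_diff algebra_simps)
    also have "\<dots> \<le> W * exp (- (2 * ln s))"
      unfolding W_def using dom[OF cop ne] Gs
      by (intro mult_mono) (auto simp: G_def intro!: mult_left_mono)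
    also have "exp (- (2 * ln s)) = 1 / s\<^sup>2"
      using s by (simp add: exp_minus inverse_eq_divide exp_double)
    finally show ?thesis by (simp add: x s_def)
  qed
  have sumE: "(\<lambda>(c, d). 1 / ((of_int c)\<^sup>2 + (of_int d)\<^sup>2)\<^sup>2 :: real) summable_on A"
    using summable_on_coprime_pairs by (rule summable_on_subset) (auto simp: A_def)
  have "norm (infsum f A) \<le> W * (\<Sum>\<^sub>\<infinity>(c, d)\<in>A. 1 / ((of_int c)\<^sup>2 + (of_int d)\<^sup>2)\<^sup>2)"
    by (rule norm_infsum_le[OF has_sum_infsum[OF sumA] has_sum_cmult_right[OF has_sum_infsum[OF sumE]]])
       (rule bound)
  also have "\<dots> \<le> W * eisenstein_bound"
    unfolding eisenstein_bound_def
    by (intro mult_left_mono infsum_mono_neutral sumE summable_on_coprime_pairs) (auto simp: A_def W_def)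
  finally have "norm (infsum f A) \<le> W * eisenstein_bound" .
  moreover have "poincare_series k m z = 1/2 * infsum f A + of_real (2 * Re T)"
    unfolding poincare_series_altdef f_def[symmetric] split sumB by (simp add: algebra_simps)
  then have "Re (poincare_series k m z) - 2 * Re T = Re (infsum f A) / 2" by simp
  ultimately show ?thesis
    using abs_Re_le_cmod[of "infsum f A"] by (simp add: z_def T_def W_def)
qed

section \<open>Linear bounds for both numbers of zeros\<close>

lemma decay_rate_le:
  assumes "\<beta> \<ge> 0" "\<beta> \<le> B" "1 \<le> y" "y \<le> b" "c \<ge> 1"
  shows "decay_rate \<beta> y c d \<le> 2 * pi * B * b + ln (c\<^sup>2 * b\<^sup>2 + d\<^sup>2) / 2"
proof -
  have "1 * 1 \<le> c\<^sup>2 * y\<^sup>2" using assms by (intro mult_mono one_le_power) auto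
  then have r: "c\<^sup>2 * y\<^sup>2 + d\<^sup>2 \<ge> 1" by (simp add: add_increasing2)
  have "2 * pi * \<beta> * y / (c\<^sup>2 * y\<^sup>2 + d\<^sup>2) \<le> 2 * pi * \<beta> * y / 1"
    using r assms by (intro divide_left_mono) auto
  also have "\<dots> \<le> 2 * pi * B * b" using assms by (auto intro!: mult_mono)
  finally have "2 * pi * \<beta> * y / (c\<^sup>2 * y\<^sup>2 + d\<^sup>2) \<le> 2 * pi * B * b" .
  moreover have "c\<^sup>2 * y\<^sup>2 \<le> c\<^sup>2 * b\<^sup>2" using assms by (intro mult_left_mono power_mono) auto
  then have "ln (c\<^sup>2 * y\<^sup>2 + d\<^sup>2) \<le> ln (c\<^sup>2 * b\<^sup>2 + d\<^sup>2)" using r by (intro ln_mono) auto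
  ultimately show ?thesis by (simp add: decay_rate_def)
qed

text \<open>On \<open>[a, b]\<close> the phase of the dominant term moves by a multiple of
  \<open>k\<close>, which yields the zeros on the axis. At a point where its cosine is 1 or -1 the
  series is exponentially bounded below, which yields the upper bound in the fundamental domain. All
  constants depend only on \<alpha>.\<close>

lemma poincare_series_zeros_bounds:
  assumes \<alpha>: "\<alpha> > ln 2 / (2 * pi)"
  obtains \<eta> \<kappa> C :: real and k0 :: nat where "\<eta> > 0" "\<kappa> > 0" "C > 0"
    "\<And>k m. \<lbrakk>even k; k \<ge> k0; \<bar>real m / k - \<alpha>\<bar> < \<eta>\<rbrakk> \<Longrightarrow>
       finite (zeros_in (poincare_series k m) fundamental_domain) \<and>
       real (card (zeros_in (poincare_series k m) imaginary_line)) \<ge> \<kappa> * k - 2 \<and>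
       real_of_int (zero_count_mult (poincare_series k m) fundamental_domain) \<le> C * k"
proof -
  obtain c d :: int and a b \<delta> \<eta> \<kappa> :: real
    where cd: "c > 0" "d > 0" "coprime c d" and ab: "1 \<le> a" "a < b" and pos: "\<delta> > 0" "\<eta> > 0" "\<kappa> > 0"
    and dom: "\<And>\<beta> y c' d'. \<lbrakk>\<beta> \<ge> 0; \<bar>\<beta> - \<alpha>\<bar> < \<eta>; a \<le> y; y \<le> b; coprime c' d'; (\<bar>c'\<bar>, \<bar>d'\<bar>) \<noteq> (c, d)\<rbrakk>
       \<Longrightarrow> decay_rate \<beta> y c d + \<delta> \<le> decay_rate \<beta> y c' d'"
    and ph: "\<And>\<beta>. \<bar>\<beta> - \<alpha>\<bar> < \<eta> \<Longrightarrow> \<kappa> \<le> \<bar>phase_rate \<beta> b c d - phase_rate \<beta> a c d\<bar>"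
    using dominant_pair[OF \<alpha>] by blast
  \<comment> \<open>Adding 1 makes the error estimate strict and \<open>ln E\<close>
    nonnegative.\<close>
  define E where "E = eisenstein_bound + 1"
  have E: "E \<ge> 1" "eisenstein_bound < E" using eisenstein_bound_nonneg by (auto simp: E_def)
  have "ln 2 / (2 * pi) > 0" by simp
  then have \<alpha>0: "\<alpha> > 0" using \<alpha> by linarith
  define K where "K = 2 * pi * (\<alpha> + \<eta>) * b + ln ((of_int c)\<^sup>2 * b\<^sup>2 + (of_int d)\<^sup>2) / 2"
  have GK: "decay_rate \<beta> y c d \<le> K" if "\<beta> \<ge> 0" "\<bar>\<beta> - \<alpha>\<bar> < \<eta>" "a \<le> y" "y \<le> b" for \<beta> y
    unfolding K_def using that ab cd by (intro decay_rate_le) auto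
  have K0: "K \<ge> 0"
  proof -
    have "0 \<le> ln ((real_of_int c)\<^sup>2 + (of_int d)\<^sup>2) / 2"
      using coprime_square_sum_ge_1[OF cd(3)] by simp
    also have "\<dots> \<le> decay_rate \<alpha> a c d"
      using \<alpha>0 ab coprime_square_sum_ge_1[OF cd(3)] by (intro decay_rate_ge) auto
    also have "\<dots> \<le> K" using \<alpha>0 pos ab by (intro GK) auto
    finally show ?thesis .
  qed
  \<comment> \<open>Solves \<open>exp (- k K) \<le> 12^(k/2) * E * 2^(-M)\<close> for
    \<open>M\<close>, with \<open>ln E\<close> bounded by \<open>k * ln E\<close>.\<close>
  define C where "C = (ln 12 / 2 + ln E + K) / ln 2"
  have C: "C > 0" unfolding C_def using K0 E by (intro divide_pos_pos add_pos_nonneg) auto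
  \<comment> \<open>The first bound lets the gain \<delta> absorb \<open>E\<close> and the four
    factors set aside, 4 gives convergence, and \<open>\<pi> / \<kappa>\<close> makes the phase move
    by at least \<pi>.\<close>
  obtain k0 :: nat where k0: "real k0 \<ge> max (4 + (4 * K + ln E) / \<delta>) (max 4 (pi / \<kappa>))"
    using real_arch_simple by blast
  show thesis
  proof (rule that[of \<eta> "\<kappa> / pi" C k0])
    fix k m :: nat
    assume ek: "even k" and kk0: "k \<ge> k0" and near: "\<bar>real m / k - \<alpha>\<bar> < \<eta>"
    have kr: "real k \<ge> 4 + (4 * K + ln E) / \<delta>" "real k \<ge> 4" "real k \<ge> pi / \<kappa>"
      using k0 kk0 by (auto simp: of_nat_le_iff[symmetric] simp del: of_nat_le_iff)
    have k4: "k \<ge> 4" using kr(2) by linarith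
    have \<kappa>k: "\<kappa> * k \<ge> pi" using kr(3) pos by (simp add: field_simps)
    define \<beta> where "\<beta> = real m / k"
    have \<beta>: "\<beta> \<ge> 0" "\<bar>\<beta> - \<alpha>\<bar> < \<eta>" using near by (auto simp: \<beta>_def)
    have "(4 * K + ln E) / \<delta> \<le> real k - 4" using kr(1) by linarith
    then have kd: "4 * K + ln E \<le> (real k - 4) * \<delta>" using pos by (simp add: field_simps)
    obtain \<theta> where \<theta>: "\<And>y. y > 0 \<Longrightarrow> Re (poincare_term k m (of_real y * \<i>) c d) =
      exp (- (real k * decay_rate \<beta> y c d)) * cos (real k * phase_rate \<beta> y c d + \<theta>)"
      unfolding \<beta>_def using poincare_term_polar[OF cd, of k m] k4 by auto
    \<comment> \<open>Orients the phase so that it rises from \<open>a\<close> to \<open>b\<close>;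
      the cosine is even.\<close>
    define \<sigma> :: real where "\<sigma> = (if phase_rate \<beta> b c d \<ge> phase_rate \<beta> a c d then 1 else -1)"
    define \<phi> where "\<phi> y = \<sigma> * (real k * phase_rate \<beta> y c d + \<theta>)" for y
    have cos\<phi>: "cos (\<phi> y) = cos (real k * phase_rate \<beta> y c d + \<theta>)" for y
    proof (cases "\<sigma> = 1")
      case False
      then have "\<phi> y = - (real k * phase_rate \<beta> y c d + \<theta>)" by (simp add: \<phi>_def \<sigma>_def split: if_splits)
      then show ?thesis by (simp only: cos_minus)
    qed (simp add: \<phi>_def)
    define F where "F y = Re (poincare_series k m (of_real y * \<i>))" for y
    define \<rho> where "\<rho> y = 2 * exp (- (real k * decay_rate \<beta> y c d))" for y
    \<comment> \<open>Half of the amplitude, so that the series is still at least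
      \<open>\<rho> / 2\<close> in absolute value where the cosine is 1 or -1.\<close>
    have err: "\<bar>F y - \<rho> y * cos (\<phi> y)\<bar> < \<rho> y / 2" if y: "y \<in> {a..b}" for y
    proof -
      define G where "G = decay_rate \<beta> y c d"
      have G: "G \<le> K" unfolding G_def using \<beta> y by (intro GK) auto
      have "\<bar>F y - \<rho> y * cos (\<phi> y)\<bar> \<le> exp (- (real (k - 4) * (G + \<delta>))) * eisenstein_bound"
        using poincare_series_dominated[OF ek k4 _ cd, of y m \<delta>] dom[OF \<beta>] y ab \<theta>[of y]
        by (simp add: F_def \<rho>_def cos\<phi> G_def \<beta>_def mult.assoc)
      also have "\<dots> < exp (- (real (k - 4) * (G + \<delta>))) * E"
        using E by (intro mult_strict_left_mono) auto
      also have "\<dots> = exp (- (real (k - 4) * (G + \<delta>)) + ln E)" using E unfolding exp_add by simp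
      also have "\<dots> \<le> exp (- (real k * G))"
      proof -
        have "- (real (k - 4) * (G + \<delta>)) + ln E = - (real k * G) + 4 * G - (real k - 4) * \<delta> + ln E"
          using k4 by (simp add: of_nat_diff algebra_simps)
        also have "\<dots> \<le> - (real k * G)" using kd G by linarith
        finally show ?thesis by simp
      qed
      also have "\<dots> = \<rho> y / 2" by (simp add: \<rho>_def G_def)
      finally show ?thesis .
    qed
    have contF: "continuous_on {a..b} F"
    proof -
      have "continuous_on {z. Im z > 1/2} (poincare_series k m)"
        by (rule holomorphic_on_imp_continuous_on[OF poincare_series_holomorphic[OF ek k4]])
      then have "continuous_on {a..b} (\<lambda>y. poincare_series k m (of_real y * \<i>))"
        by (rule continuous_on_compose2) (use ab in \<open>auto intro!: continuous_intros\<close>)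
      then show ?thesis unfolding F_def by (intro continuous_intros)
    qed
    have cont\<phi>: "continuous_on {a..b} \<phi>"
    proof -
      have "c * ((real_of_int c)\<^sup>2 * y\<^sup>2 + (of_int d)\<^sup>2) \<noteq> 0" if "y \<in> {a..b}" for y
        using square_form_pos[of y c d] that ab cd by auto
      then show ?thesis unfolding \<phi>_def phase_rate_def using cd
        by (intro continuous_intros) auto
    qed
    have rise: "\<phi> b - \<phi> a \<ge> \<kappa> * k"
    proof -
      have "\<phi> b - \<phi> a = real k * \<bar>phase_rate \<beta> b c d - phase_rate \<beta> a c d\<bar>"
        by (simp add: \<phi>_def \<sigma>_def abs_if algebra_simps)
      then show ?thesis using mult_left_mono[OF ph[OF \<beta>(2)], of "real k"] by (simp add: mult.commute)
    qed
    define n where "n = \<lceil>\<phi> a / pi\<rceil>"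
    \<comment> \<open>One is subtracted to make up for rounding \<open>\<phi> a / \<pi>\<close> up
      to the integer \<open>n\<close>.\<close>
    define N where "N = nat (\<lfloor>\<kappa> * k / pi\<rfloor> - 1)"
    have "1 \<le> \<kappa> * k / pi" using \<kappa>k by simp
    then have "1 \<le> \<lfloor>\<kappa> * k / pi\<rfloor>" by simp
    then have Nint: "int N = \<lfloor>\<kappa> * k / pi\<rfloor> - 1" by (simp add: N_def)
    then have "real N = of_int (\<lfloor>\<kappa> * k / pi\<rfloor> - 1)" by (metis of_int_of_nat_eq)
    then have N: "real N \<ge> \<kappa> * k / pi - 2" "real N \<le> \<kappa> * k / pi - 1"
      by linarith+
    have n1: "\<phi> a \<le> n * pi"
      using le_of_int_ceiling[of "\<phi> a / pi"] pos_divide_le_eq[OF pi_gt_zero] unfolding n_def by blast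
    have n2: "(n + int N) * pi \<le> \<phi> b"
    proof -
      have "real_of_int n \<le> \<phi> a / pi + 1" unfolding n_def by linarith
      then have "real_of_int n + real N \<le> \<phi> a / pi + \<kappa> * k / pi" using N(2) by linarith
      also have "\<dots> \<le> \<phi> b / pi" using rise by (simp add: divide_right_mono flip: add_divide_distrib)
      finally show ?thesis by (simp add: pos_le_divide_eq)
    qed
    have \<rho>pos: "\<rho> y > 0" for y by (simp add: \<rho>_def)
    have "\<bar>F y - \<rho> y * cos (\<phi> y)\<bar> < \<rho> y" if "y \<in> {a..b}" for y
      using err[OF that] \<rho>pos[of y] by linarith
    from oscillation_zeros[OF contF cont\<phi> _ this n1 n2] ab obtain y0 Z where
      y0: "y0 \<in> {a..b}" "\<phi> y0 = n * pi" and Z: "finite Z" "card Z = N" "Z \<subseteq> {y0<..b}" "\<And>y. y \<in> Z \<Longrightarrow> F y = 0"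
      by auto
    have "\<bar>cos (\<phi> y0)\<bar> = 1" unfolding y0 by (simp add: cos_npi_int mult.commute[of _ pi])
    then have "\<bar>\<rho> y0 * cos (\<phi> y0)\<bar> = \<rho> y0" using \<rho>pos[of y0] by (simp add: abs_mult)
    then have "\<bar>F y0\<bar> \<ge> \<rho> y0 / 2" using err[OF y0(1)] by linarith
    moreover have "\<bar>F y0\<bar> \<le> norm (poincare_series k m (of_real y0 * \<i>))"
      unfolding F_def by (rule abs_Re_le_cmod)
    moreover have "\<rho> y0 / 2 \<ge> exp (- (real k * K))"
      unfolding \<rho>_def using GK[OF \<beta>, of y0] y0 by (auto intro!: mult_left_mono)
    ultimately have low: "norm (poincare_series k m (of_real y0 * \<i>)) \<ge> exp (- (real k * K))" by linarith
    then have "poincare_series k m (of_real y0 * \<i>) \<noteq> 0" by (metis exp_gt_zero norm_zero not_less)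
    moreover have "y0 \<ge> 1" using y0 ab by auto
    ultimately have fin: "finite (zeros_in (poincare_series k m) fundamental_domain)"
      and up: "norm (poincare_series k m (of_real y0 * \<i>)) \<le> 12 ^ (k div 2) * eisenstein_bound *
           (1/2) ^ nat (zero_count_mult (poincare_series k m) fundamental_domain)"
      using poincare_series_zero_count_le[OF ek k4] by blast+
    define M where "M = nat (zero_count_mult (poincare_series k m) fundamental_domain)"
    have "exp (- (real k * K)) \<le> 12 ^ (k div 2) * E * (1/2) ^ M"
    proof -
      have "12 ^ (k div 2) * eisenstein_bound * (1/2) ^ M \<le> 12 ^ (k div 2) * E * (1/2) ^ M"
        using E by (intro mult_right_mono mult_left_mono) auto
      then show ?thesis using low up unfolding M_def by linarith
    qed
    then have "ln (exp (- (real k * K))) \<le> ln (12 ^ (k div 2) * E * (1/2) ^ M)"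
      using E by (intro ln_mono) auto
    then have "- (real k * K) \<le> real (k div 2) * ln 12 + ln E - real M * ln 2"
      using E by (simp add: ln_mult ln_realpow ln_div)
    moreover have "real (k div 2) = real k / 2" using ek by (simp add: real_of_nat_div)
    moreover have "ln E \<le> real k * ln E"
      using E k4 by (simp add: mult_le_cancel_right1)
    ultimately have "real M * ln 2 \<le> (ln 12 / 2 + ln E + K) * k" by (simp add: algebra_simps)
    then have "real M \<le> C * k" by (simp add: C_def field_simps)
    moreover have "real_of_int (zero_count_mult (poincare_series k m) fundamental_domain) \<le> real M"
      unfolding M_def by linarith
    ultimately have cnt: "real_of_int (zero_count_mult (poincare_series k m) fundamental_domain) \<le> C * k" by linarith
    have finL: "finite (zeros_in (poincare_series k m) imaginary_line)"
      by (rule finite_subset[OF _ fin]) (use imaginary_line_subset in \<open>auto simp: zeros_in_def\<close>)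
    have "(\<lambda>y. of_real y * \<i>) ` Z \<subseteq> zeros_in (poincare_series k m) imaginary_line"
    proof safe
      fix y assume y: "y \<in> Z"
      then have y1: "y \<ge> 1" using Z(3) \<open>y0 \<ge> 1\<close> by auto
      then have "poincare_series k m (of_real y * \<i>) \<in> \<real>"
        by (intro poincare_series_imaginary_axis_real ek) auto
      moreover have "Re (poincare_series k m (of_real y * \<i>)) = 0" using Z(4)[OF y] by (simp add: F_def)
      ultimately have "poincare_series k m (of_real y * \<i>) = 0"
        by (simp add: complex_eq_iff complex_is_Real_iff)
      then show "of_real y * \<i> \<in> zeros_in (poincare_series k m) imaginary_line"
        using y1 by (auto simp: zeros_in_def imaginary_line_def)
    qed
    then have "card ((\<lambda>y. of_real y * \<i>) ` Z) \<le> card (zeros_in (poincare_series k m) imaginary_line)"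
      by (rule card_mono[OF finL])
    moreover have "card ((\<lambda>y. of_real y * \<i>) ` Z) = N"
      using Z(2) by (subst card_image) (auto simp: inj_on_def)
    ultimately have "real (card (zeros_in (poincare_series k m) imaginary_line)) \<ge> \<kappa> / pi * k - 2"
      using N(1) by simp
    with fin cnt show "finite (zeros_in (poincare_series k m) fundamental_domain) \<and>
       real (card (zeros_in (poincare_series k m) imaginary_line)) \<ge> \<kappa> / pi * k - 2 \<and>
       real_of_int (zero_count_mult (poincare_series k m) fundamental_domain) \<le> C * k" by blast
  qed (use pos C in auto)
qed

theorem theorem1p2:
  fixes \<alpha> :: real
  assumes "\<alpha> > ln 2 / (2 * pi)"
  shows "\<exists>P>0. \<exists>C>0. \<forall>m :: nat \<Rightarrow> nat.
    (\<forall>k. even k \<and> k > 0 \<longrightarrow> m k \<ge> 1) \<longrightarrow>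
    (\<lambda>k. real (m k) - \<alpha> * real k) \<in> o[even_at_top](\<lambda>k. real k) \<longrightarrow>
      (\<exists>e \<in> o[even_at_top](\<lambda>k. real k). \<forall>\<^sub>F k in even_at_top.
         real (card (zeros_in (poincare_series k (m k)) imaginary_line))
           \<ge> P * (real k / 12) + e k) \<and>
      (\<forall>\<^sub>F k in even_at_top.
         finite (zeros_in (poincare_series k (m k)) fundamental_domain) \<and>
         real (card (zeros_in (poincare_series k (m k)) imaginary_line))
           \<ge> C * real_of_int (zero_count_mult (poincare_series k (m k)) fundamental_domain))"
proof -
  obtain \<eta> \<kappa> C :: real and k0 :: nat where pos: "\<eta> > 0" "\<kappa> > 0" "C > 0" and bnd:
    "\<And>k m. \<lbrakk>even k; k \<ge> k0; \<bar>real m / k - \<alpha>\<bar> < \<eta>\<rbrakk> \<Longrightarrow>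
       finite (zeros_in (poincare_series k m) fundamental_domain) \<and>
       real (card (zeros_in (poincare_series k m) imaginary_line)) \<ge> \<kappa> * k - 2 \<and>
       real_of_int (zero_count_mult (poincare_series k m) fundamental_domain) \<le> C * k"
    using poincare_series_zeros_bounds[OF assms] by blast
  show ?thesis
  \<comment> \<open>The factor 12 cancels the \<open>k / 12\<close> of the statement. The proportion
    is half of \<open>\<kappa> / C\<close>, which leaves room for the error term
    \<open>-2\<close>.\<close>
  proof (rule exI[of _ "12 * \<kappa>"], intro conjI, use pos in simp,
      rule exI[of _ "\<kappa> / (2 * C)"], intro conjI, use pos in simp, intro allI impI)
    fix m :: "nat \<Rightarrow> nat"
    assume small: "(\<lambda>k. real (m k) - \<alpha> * real k) \<in> o[even_at_top](\<lambda>k. real k)"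
    have large: "\<forall>\<^sub>F k in even_at_top. even k \<and> k \<ge> K" for K
      unfolding even_at_top_def eventually_inf_principal
      using eventually_ge_at_top[of K] by eventually_elim simp
    have "\<forall>\<^sub>F k in even_at_top. \<bar>real (m k) - \<alpha> * real k\<bar> \<le> \<eta> / 2 * real k"
      using landau_o.smallD[OF small, of "\<eta> / 2"] pos by simp
    with large[of "max 1 k0"]
    have ev: "\<forall>\<^sub>F k in even_at_top. finite (zeros_in (poincare_series k (m k)) fundamental_domain) \<and>
       real (card (zeros_in (poincare_series k (m k)) imaginary_line)) \<ge> \<kappa> * k - 2 \<and>
       real_of_int (zero_count_mult (poincare_series k (m k)) fundamental_domain) \<le> C * k"
    proof eventually_elim
      case (elim k)
      then have k: "real k > 0" by simp
      have "real (m k) / k - \<alpha> = (real (m k) - \<alpha> * k) / k" using k by (simp add: field_simps)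
      then have "\<bar>real (m k) / k - \<alpha>\<bar> = \<bar>real (m k) - \<alpha> * k\<bar> / k" by simp
      also have "\<dots> \<le> \<eta> / 2" using elim k by (simp add: divide_le_eq)
      also have "\<dots> < \<eta>" using pos by simp
      finally show ?case using bnd elim by auto
    qed
    show "(\<exists>e \<in> o[even_at_top](\<lambda>k. real k). \<forall>\<^sub>F k in even_at_top.
         real (card (zeros_in (poincare_series k (m k)) imaginary_line))
           \<ge> 12 * \<kappa> * (real k / 12) + e k) \<and>
      (\<forall>\<^sub>F k in even_at_top.
         finite (zeros_in (poincare_series k (m k)) fundamental_domain) \<and>
         real (card (zeros_in (poincare_series k (m k)) imaginary_line))
           \<ge> \<kappa> / (2 * C) * real_of_int (zero_count_mult (poincare_series k (m k)) fundamental_domain))"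
    proof (intro conjI bexI)
      show "\<forall>\<^sub>F k in even_at_top. real (card (zeros_in (poincare_series k (m k)) imaginary_line))
           \<ge> 12 * \<kappa> * (real k / 12) + (- 2)"
        using ev by eventually_elim simp
      have "(\<lambda>_. - 2) \<in> o[at_top](\<lambda>k. real k)"
        by (rule smalloI_tendsto, rule lim_const_over_n)
           (auto intro: eventually_mono[OF eventually_gt_at_top[of 0]])
      then show "(\<lambda>_. - 2) \<in> o[even_at_top](\<lambda>k. real k)"
        by (rule landau_o.small.filter_mono[rotated]) (simp add: even_at_top_def)
      \<comment> \<open>From \<open>k \<ge> 4 / \<kappa>\<close> on,
        \<open>\<kappa> * k - 2 \<ge> \<kappa> * k / 2\<close>.\<close>
      obtain K :: nat where K: "real K \<ge> 4 / \<kappa>" using real_arch_simple by blast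
      show "\<forall>\<^sub>F k in even_at_top.
         finite (zeros_in (poincare_series k (m k)) fundamental_domain) \<and>
         real (card (zeros_in (poincare_series k (m k)) imaginary_line))
           \<ge> \<kappa> / (2 * C) * real_of_int (zero_count_mult (poincare_series k (m k)) fundamental_domain)"
        using ev large[of K]
      proof eventually_elim
        case (elim k)
        have "\<kappa> / (2 * C) * real_of_int (zero_count_mult (poincare_series k (m k)) fundamental_domain)
            \<le> \<kappa> / (2 * C) * (C * k)"
          using elim pos by (intro mult_left_mono) auto
        also have "\<dots> = \<kappa> * k / 2" using pos by simp
        also have "\<dots> \<le> \<kappa> * k - 2"
        proof -
          have "4 / \<kappa> \<le> real k" using K elim by (meson of_nat_le_iff order_trans)
          then show ?thesis using pos by (simp add: field_simps)
        qed
        finally show ?case using elim by linarith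
      qed
    qed
  qed
qed

end
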